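(* (i) For any signed graph $(G,\sigma)$, if $G$ is planar and $(G,\sigma)$ is $2$-colorable, then $AT(G,\sigma)\le 4$. (ii) There exists a signed graph $(G,\sigma)$ with $G$ planar such that $(G,\sigma)$ is $2$-colorable but not $3$-choosable.
   Context: A signed graph $(G,\sigma)$ consists of a finite simple graph $G$ and a map $\sigma\colon E(G)\to\{+1,-1\}$. A proper coloring of $(G,\sigma)$ with color set $C\subset\mathbb{Z}$ is a map $\phi\colon V(G)\to C$ with $\phi(u)\neq\sigma(uv)\phi(v)$ for every edge $uv$. For $k\ge1$, $M_k=\{\pm1,\dots,\pm k/2\}$ if $k$ is even and $M_k=\{0,\pm1,\dots,\pm(k-1)/2\}$ if $k$ is odd; $(G,\sigma)$ is $k$-colorable if it has a proper coloring with color set $M_k$ (so $2$-colorable means a proper coloring with colors in $\{1,-1\}$). A $k$-list assignment assigns to each vertex $v$ a set $L(v)\subset\mathbb{Z}$ with $|L(v)|=k$; an $L$-coloring is a proper coloring $\phi$ with $\phi(v)\in L(v)$ for all $v$; $(G,\sigma)$ is $k$-choosable if it has an $L$-coloring for every $k$-list assignment $L$. Fix a linear ordering $<$ of $V(G)$; the graph polynomial is $P_{G,\sigma}(\mathbf{x})=\prod_{uv\in E(G),\,u<v}(x_u-\sigma(uv)x_v)$, and $AT(G,\sigma)$ is the minimum $k$ such that its expansion contains a monomial $c\prod_v x_v^{t_v}$ with $c\neq0$ and $t_v<k$ for all $v$. *)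

theory Defs
  imports "HOL-Analysis.Analysis" "HOL-Library.Poly_Mapping"
begin

text \<open>
  A signed graph is given by its vertex set \<open>V\<close>, its edge set \<open>E\<close> (a set of two-element subsets
  of \<open>V\<close>, so the graph is simple) and a signature \<open>\<sigma>\<close>, whose values outside \<open>E\<close> are irrelevant.
\<close>

definition signed_graph :: "'a set \<Rightarrow> 'a set set \<Rightarrow> ('a set \<Rightarrow> int) \<Rightarrow> bool" where
  "signed_graph V E \<sigma> \<longleftrightarrow>
     finite V \<and> (\<forall>e\<in>E. e \<subseteq> V \<and> card e = 2) \<and> (\<forall>e\<in>E. \<sigma> e \<in> {1, -1})"

text \<open>
  A drawing in the plane (represented by \<^typ>\<open>complex\<close>, as in the library's Jordan curve theorem):
  \<open>p\<close> places the vertices at distinct points; \<open>\<gamma> e\<close> is a simple arc joining the ends of \<open>e\<close> that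
  passes through no other vertex; two distinct edges meet at most in common ends.
\<close>

definition plane_drawing ::
    "'a set \<Rightarrow> 'a set set \<Rightarrow> ('a \<Rightarrow> complex) \<Rightarrow> ('a set \<Rightarrow> real \<Rightarrow> complex) \<Rightarrow> bool" where
  "plane_drawing V E p \<gamma> \<longleftrightarrow>
     inj_on p V \<and>
     (\<forall>e\<in>E. arc (\<gamma> e) \<and> {pathstart (\<gamma> e), pathfinish (\<gamma> e)} = p ` e \<and>
             path_image (\<gamma> e) \<inter> p ` V = p ` e) \<and>
     (\<forall>e\<in>E. \<forall>f\<in>E. e \<noteq> f \<longrightarrow> path_image (\<gamma> e) \<inter> path_image (\<gamma> f) \<subseteq> p ` (e \<inter> f))"

definition planar :: "'a set \<Rightarrow> 'a set set \<Rightarrow> bool" where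
  "planar V E \<longleftrightarrow> (\<exists>p \<gamma>. plane_drawing V E p \<gamma>)"

definition proper_coloring ::
    "'a set \<Rightarrow> 'a set set \<Rightarrow> ('a set \<Rightarrow> int) \<Rightarrow> int set \<Rightarrow> ('a \<Rightarrow> int) \<Rightarrow> bool" where
  "proper_coloring V E \<sigma> C \<phi> \<longleftrightarrow>
     (\<forall>v\<in>V. \<phi> v \<in> C) \<and>
     (\<forall>u\<in>V. \<forall>v\<in>V. {u, v} \<in> E \<longrightarrow> \<phi> u \<noteq> \<sigma> {u, v} * \<phi> v)"

definition sym_colors :: "nat \<Rightarrow> int set" where
  "sym_colors k =
     (if even k then {- int (k div 2) .. int (k div 2)} - {0}
      else {- int ((k - 1) div 2) .. int ((k - 1) div 2)})"

definition colorable :: "'a set \<Rightarrow> 'a set set \<Rightarrow> ('a set \<Rightarrow> int) \<Rightarrow> nat \<Rightarrow> bool" where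
  "colorable V E \<sigma> k \<longleftrightarrow> (\<exists>\<phi>. proper_coloring V E \<sigma> (sym_colors k) \<phi>)"

definition list_assignment :: "'a set \<Rightarrow> nat \<Rightarrow> ('a \<Rightarrow> int set) \<Rightarrow> bool" where
  "list_assignment V k L \<longleftrightarrow> (\<forall>v\<in>V. finite (L v) \<and> card (L v) = k)"

definition list_coloring ::
    "'a set \<Rightarrow> 'a set set \<Rightarrow> ('a set \<Rightarrow> int) \<Rightarrow> ('a \<Rightarrow> int set) \<Rightarrow> ('a \<Rightarrow> int) \<Rightarrow> bool" where
  "list_coloring V E \<sigma> L \<phi> \<longleftrightarrow> proper_coloring V E \<sigma> UNIV \<phi> \<and> (\<forall>v\<in>V. \<phi> v \<in> L v)"

definition choosable :: "'a set \<Rightarrow> 'a set set \<Rightarrow> ('a set \<Rightarrow> int) \<Rightarrow> nat \<Rightarrow> bool" where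
  "choosable V E \<sigma> k \<longleftrightarrow>
     (\<forall>L. list_assignment V k L \<longrightarrow> (\<exists>\<phi>. list_coloring V E \<sigma> L \<phi>))"

text \<open>
  Polynomials in variables indexed by \<open>'a\<close>: a power product is an exponent function
  \<^typ>\<open>'a \<Rightarrow>\<^sub>0 nat\<close>, and a polynomial maps each power product to its coefficient; the library's
  multiplication on this type is the convolution product.
\<close>

definition var :: "'a \<Rightarrow> ('a \<Rightarrow>\<^sub>0 nat) \<Rightarrow>\<^sub>0 int" where
  "var v = Poly_Mapping.single (Poly_Mapping.single v 1) 1"

text \<open>The fixed linear ordering of the vertices is that of the vertex type.\<close>

definition graph_poly ::
    "'a::linorder set set \<Rightarrow> ('a set \<Rightarrow> int) \<Rightarrow> ('a \<Rightarrow>\<^sub>0 nat) \<Rightarrow>\<^sub>0 int" where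
  "graph_poly E \<sigma> = (\<Prod>(u, v)\<in>{(u, v). u < v \<and> {u, v} \<in> E}. var u - of_int (\<sigma> {u, v}) * var v)"

definition AT_bound :: "'a::linorder set \<Rightarrow> 'a set set \<Rightarrow> ('a set \<Rightarrow> int) \<Rightarrow> nat \<Rightarrow> bool" where
  "AT_bound V E \<sigma> k \<longleftrightarrow>
     (\<exists>t. Poly_Mapping.lookup (graph_poly E \<sigma>) t \<noteq> 0 \<and> (\<forall>v\<in>V. Poly_Mapping.lookup t v < k))"

definition AT_number :: "'a::linorder set \<Rightarrow> 'a set set \<Rightarrow> ('a set \<Rightarrow> int) \<Rightarrow> nat" where
  "AT_number V E \<sigma> = (LEAST k. AT_bound V E \<sigma> k)"

text \<open>The minimum above is taken over a nonempty set.\<close>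

lemma graph_poly_nonzero:
  assumes "signed_graph V E \<sigma>"
  shows "graph_poly E \<sigma> \<noteq> 0"
proof -
  let ?S = "{(u, v). u < v \<and> {u, v} \<in> E}"
  have "?S \<subseteq> V \<times> V" "finite V"
    using assms by (auto simp: signed_graph_def)
  then have "finite ?S"
    by (meson finite_SigmaI finite_subset)
  moreover have "var u - of_int c * var v \<noteq> 0" if "u < v" for u v :: 'a and c :: int
  proof
    assume eq: "var u - of_int c * var v = 0"
    have ne: "Poly_Mapping.single v (1::nat) \<noteq> Poly_Mapping.single u 1"
      using that by (metis lookup_single_eq lookup_single_not_eq less_irrefl zero_neq_one)
    have "of_int c * var v = Poly_Mapping.single (Poly_Mapping.single v 1) c"
      unfolding var_def single_of_int [symmetric] mult_single by simp
    then have "Poly_Mapping.lookup (var u - of_int c * var v) (Poly_Mapping.single u 1) = 1"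
      using ne by (simp add: var_def lookup_minus lookup_single_not_eq)
    with eq show False
      by simp
  qed
  ultimately show ?thesis
    unfolding graph_poly_def by (auto simp: prod_zero_iff)
qed

lemma AT_number_attained:
  assumes "signed_graph V E \<sigma>"
  shows "AT_bound V E \<sigma> (AT_number V E \<sigma>)"
proof -
  obtain t where t: "Poly_Mapping.lookup (graph_poly E \<sigma>) t \<noteq> 0"
    using graph_poly_nonzero [OF assms] by (metis poly_mapping_eqI lookup_zero)
  have "finite V"
    using assms by (simp add: signed_graph_def)
  then have "\<forall>v\<in>V. Poly_Mapping.lookup t v < Suc (\<Sum>v\<in>V. Poly_Mapping.lookup t v)"
    by (simp add: less_Suc_eq_le member_le_sum)
  with t have "AT_bound V E \<sigma> (Suc (\<Sum>v\<in>V. Poly_Mapping.lookup t v))"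
    unfolding AT_bound_def by blast
  then show ?thesis
    unfolding AT_number_def by (rule LeastI)
qed

end

theory Submission
  imports Defs
begin

text \<open>
  (i) A proper colouring \<open>\<phi>\<close> with colours \<open>\<plusminus>1\<close> allows to substitute \<open>\<phi>(v) x\<^sub>v\<close> for \<open>x\<^sub>v\<close>, which turns
  the graph polynomial into \<open>\<plusminus>\<Prod>(x\<^sub>u + x\<^sub>v)\<close>. Nothing cancels there, so it suffices to orient the edges
  with all outdegrees at most 3. By Hall's condition this is possible because every subgraph with \<open>n\<close>
  vertices has at most \<open>3n\<close> edges. Instead of Euler's formula, the edge bound is obtained from Mader's
  argument on graphs without \<open>K\<^sub>5\<close> minor, carried out directly on drawings whose vertices are continua.

  (ii) Nine disjoint edges are joined completely to two further vertices, all edges being negative. For each of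
  the nine pairs of colours of these two vertices, the lists on one of the edges rule out that pair.
\<close>

section \<open>Arcs and separation in the plane\<close>

text \<open>Up to switching, a 2-colorable signed graph is one with negative edges only. All factors
  of its polynomial are sums, so (i) becomes a question about edge density, and exponents at most 3
  give the bound 4. Odd cycles do not obstruct such a coloring; that is the room (ii) exploits with
  its triangles, since bipartite planar graphs with positive signs are 3-choosable. The obstacle in
  (i) is that planarity is given by arbitrary arcs, with no faces to count. Mader's argument asks
  little of a drawing: it must survive deletion and contraction, and it must not exist for K5. The
  last point is the real topological input, and there the Jordan curve theorem and Janiszewski's
  theorem suffice.\<close>

lemma arc_between_closed:
  fixes U K1 K2 :: "complex set"
  assumes U: "path_connected U" and K: "closed K1" "closed K2" "K1 \<inter> K2 = {}"
    and "x \<in> U \<inter> K1" "y \<in> U \<inter> K2"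
  obtains g where "arc g" "path_image g \<subseteq> U" "pathstart g \<in> K1" "pathfinish g \<in> K2"
    "g ` {0<..<1} \<inter> (K1 \<union> K2) = {}"
proof -
  have xy: "x \<noteq> y" "x \<in> U" "y \<in> U" "x \<in> K1" "y \<in> K2" using assms by auto
  then obtain f where f: "arc f" "path_image f \<subseteq> U" "pathstart f = x" "pathfinish f = y"
    using U unfolding path_connected_arcwise by metis
  have cf: "continuous_on {0..1} f" using f(1) by (simp add: arc_def path_def)
  \<comment> \<open>The arc is cut at its last visit \<open>t1\<close> to \<open>K1\<close> and then
    at its first later visit \<open>t2\<close> to \<open>K2\<close>. Both times exist because the
    preimages are compact, and they differ because \<open>K1\<close> and \<open>K2\<close> are
    disjoint.\<close>
  define T1 where "T1 = {t\<in>{0..1}. f t \<in> K1}"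
  have "closed T1" unfolding T1_def
    using continuous_closed_preimage[OF cf _ K(1)] by (simp add: vimage_def Int_def)
  then have "compact T1"
    by (auto simp: compact_eq_bounded_closed T1_def intro: bounded_subset[of "{0..1}"])
  moreover have "0 \<in> T1" using f(3) xy by (auto simp: T1_def pathstart_def)
  ultimately obtain t1 where t1: "t1 \<in> T1" "\<And>t. t \<in> T1 \<Longrightarrow> t \<le> t1"
    using compact_attains_sup[of T1] by blast
  have ct: "continuous_on {t1..1} f" using cf t1(1) by (auto simp: T1_def intro: continuous_on_subset)
  define T2 where "T2 = {t\<in>{t1..1}. f t \<in> K2}"
  have "closed T2" unfolding T2_def
    using continuous_closed_preimage[OF ct _ K(2)] by (simp add: vimage_def Int_def)
  then have "compact T2"
    by (auto simp: compact_eq_bounded_closed T2_def intro: bounded_subset[of "{t1..1}"])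
  moreover have "1 \<in> T2" using f(4) xy t1(1) by (auto simp: T2_def T1_def pathfinish_def)
  ultimately obtain t2 where t2: "t2 \<in> T2" "\<And>t. t \<in> T2 \<Longrightarrow> t2 \<le> t"
    using compact_attains_inf[of T2] by blast
  have "t1 \<noteq> t2" using t1(1) t2(1) K(3) by (auto simp: T1_def T2_def)
  then have t12: "0 \<le> t1" "t1 < t2" "t2 \<le> 1" using t1(1) t2(1) by (auto simp: T1_def T2_def)
  show thesis
  proof
    show "arc (subpath t1 t2 f)" using f(1) t12 by (intro arc_subpath_arc) auto
    show "path_image (subpath t1 t2 f) \<subseteq> U"
      using path_image_subpath_subset[of t1 t2 f] f(2) t12 by auto
    show "pathstart (subpath t1 t2 f) \<in> K1" "pathfinish (subpath t1 t2 f) \<in> K2"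
      using t1(1) t2(1) by (auto simp: T1_def T2_def)
    show "subpath t1 t2 f ` {0<..<1} \<inter> (K1 \<union> K2) = {}"
    proof (rule ccontr)
      assume "subpath t1 t2 f ` {0<..<1} \<inter> (K1 \<union> K2) \<noteq> {}"
      then obtain s where "s \<in> {0<..<1}" "subpath t1 t2 f s \<in> K1 \<union> K2"
        by blast
      then have s: "0 < s" "s < 1" "f ((t2 - t1) * s + t1) \<in> K1 \<union> K2"
        by (simp_all add: subpath_def)
      have "t1 < (t2 - t1) * s + t1" "(t2 - t1) * s + t1 < t2"
        using s t12 mult_strict_left_mono[of s 1 "t2 - t1"] mult_pos_pos[of "t2 - t1" s]
        by (simp_all add: algebra_simps)
      with s(3) t12 t1(2)[of "(t2 - t1) * s + t1"] t2(2)[of "(t2 - t1) * s + t1"]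
      show False by (auto simp: T1_def T2_def)
    qed
  qed
qed

lemma path_image_eq_open_part:
  "path_image g = insert (pathstart g) (insert (pathfinish g) (g ` {0<..<1}))"
proof -
  have "{0..1::real} = insert 0 (insert 1 {0<..<1})" by auto
  then show ?thesis by (simp add: path_image_def pathstart_def pathfinish_def)
qed

lemma path_open_part:
  fixes g :: "real \<Rightarrow> 'b::real_normed_vector"
  assumes "path g"
  shows "connected (g ` {0<..<1})" "path_image g \<subseteq> closure (g ` {0<..<1})"
proof -
  show "connected (g ` {0<..<1})"
    using assms by (intro connected_continuous_image) (auto simp: path_def intro: continuous_on_subset)
  have "continuous_on (closure {0<..<1}) g" using assms by (simp add: path_def)
  then have "g ` closure {0<..<1} \<subseteq> closure (g ` {0<..<1})"
    by (rule image_closure_subset) (auto simp: closure_subset)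
  then show "path_image g \<subseteq> closure (g ` {0<..<1})" by (simp add: path_image_def)
qed

text \<open>Two arcs that reach the same continuum may land at different points; a tail inside
  \<open>A\<close> makes their ends agree. No self-crossing arises because \<open>g\<close> meets
  \<open>A\<close> only at its end. The added part \<open>K\<close> is recorded as a compact
  connected set for the later use of Janiszewski's theorem.\<close>

lemma arc_extend_into:
  fixes g :: "real \<Rightarrow> 'b::euclidean_space"
  assumes "arc g" "path_connected A" "path_image g \<inter> A = {pathfinish g}" "a \<in> A"
  obtains h K where "arc h" "pathstart h = pathstart g" "pathfinish h = a"
    "path_image h = path_image g \<union> K" "compact K" "connected K" "K \<subseteq> A" "a \<in> K" "pathfinish g \<in> K"
proof (cases "a = pathfinish g")
  case True
  show thesis by (rule that[of g "{a}"]) (use assms True in auto)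
next
  case False
  have "pathfinish g \<in> A" using assms(3) by auto
  with False assms obtain f where f: "arc f" "path_image f \<subseteq> A" "pathstart f = pathfinish g" "pathfinish f = a"
    unfolding path_connected_arcwise by metis
  show thesis
  proof (rule that[of "g +++ f" "path_image f"])
    show "arc (g +++ f)" by (rule arc_join) (use assms f in auto)
    show "path_image (g +++ f) = path_image g \<union> path_image f" using f by (simp add: path_image_join)
    show "compact (path_image f)" "connected (path_image f)"
      using f(1) by (auto simp: arc_imp_path compact_path_image connected_path_image)
    show "a \<in> path_image f" "pathfinish g \<in> path_image f"
      using f(3,4) pathstart_in_path_image[of f] pathfinish_in_path_image[of f] by auto
  qed (use f in auto)
qed

text \<open>\<open>W\<close> is accessible from both \<open>S\<close> and \<open>T\<close>, and so is \<open>D\<close>. Hence a point of \<open>W\<close> and a point of \<open>D\<close>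
  are separated neither by \<open>c \<union> K \<union> S\<close> (pass near \<open>s\<close>) nor by \<open>c \<union> K \<union> T\<close> (pass near \<open>q\<close>). As
  these sets meet in the connected set \<open>c \<union> K\<close>, Janiszewski's theorem shows that their union,
  which contains \<open>J\<close>, does not separate them either.\<close>

lemma crossing_chords:
  fixes J K S T c D :: "complex set"
  assumes J: "J = K \<union> S \<union> T" and cpt: "compact K" "compact S" "compact T" "compact c"
    and ST: "S \<inter> T \<subseteq> K" and conn: "connected (c \<union> K)"
    and W: "W \<in> components (- J)" "J \<subseteq> closure W" "c \<inter> W = {}"
    and D: "connected D" "D \<inter> W = {}" "D \<inter> J = {}" "D \<inter> c = {}"
    and q: "q \<in> S" "q \<in> closure D" "q \<notin> c \<union> K \<union> T"
    and s: "s \<in> T" "s \<in> closure D" "s \<notin> c \<union> K \<union> S"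
  shows False
proof -
  have Wc: "connected W" "W \<inter> J = {}" "W \<noteq> {}"
    using W(1) in_components_connected in_components_subset in_components_nonempty by blast+
  have "D \<noteq> {}" using q(2) by auto
  then obtain x y where xy: "x \<in> W" "y \<in> D" using Wc(3) by auto
  have link: "connected_component (- X) x y"
    if X: "closed X" "X \<subseteq> J \<union> c" "z \<notin> X" "z \<in> J" "z \<in> closure D" for X z
  proof -
    obtain e where e: "e > 0" "ball z e \<subseteq> - X"
      using X openE[of "- X" z] by (auto simp: open_Compl)
    have "ball z e \<inter> W \<noteq> {}" "ball z e \<inter> D \<noteq> {}"
      using e(1) X(4,5) W(2) by (metis Int_commute open_Int_closure_eq_empty open_ball centre_in_ball
          disjoint_iff subset_eq)+
    then have "connected (ball z e \<union> W \<union> D)"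
      by (metis connected_Un connected_ball Wc(1) D(1) Int_Un_distrib2 Un_empty)
    moreover have "ball z e \<union> W \<union> D \<subseteq> - X" using e(2) X(2) Wc(2) W(3) D by blast
    ultimately show ?thesis using xy by (auto simp: connected_component_def)
  qed
  have "closed (c \<union> K \<union> S)" "closed (c \<union> K \<union> T)" using cpt by (auto intro: compact_imp_closed)
  then have "connected_component (- (c \<union> K \<union> S)) x y" "connected_component (- (c \<union> K \<union> T)) x y"
    using J s q link[of "c \<union> K \<union> S" s] link[of "c \<union> K \<union> T" q] by auto
  moreover have "(c \<union> K \<union> S) \<inter> (c \<union> K \<union> T) = c \<union> K" using ST by auto
  moreover have "compact (c \<union> K \<union> S)" "closed (c \<union> K \<union> T)" using cpt by (auto intro: compact_imp_closed)
  ultimately have "connected_component (- ((c \<union> K \<union> S) \<union> (c \<union> K \<union> T))) x y"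
    using Janiszewski[of "c \<union> K \<union> S" "c \<union> K \<union> T" x y] conn by simp
  then have "connected_component (- J) x y"
    by (rule connected_component_of_subset) (use J in auto)
  \<comment> \<open>Being a whole component, \<open>W\<close> would then contain \<open>y\<close>, a
    point of \<open>D\<close>.\<close>
  moreover have "W = connected_component_set (- J) x"
    using W(1) xy(1) by (metis components_iff connected_component_eq)
  ultimately show False using xy D(2) by auto
qed


text \<open>Away from \<open>A2\<close> the closed sets \<open>A1 \<union> L1\<close> and
  \<open>L2 \<union> A3\<close> are disjoint, so an arc that missed \<open>A2\<close> would be
  disconnected. This yields half of a closed curve along a 4-cycle; the curve has to touch the
  middle vertex too, since chords will start there.\<close>

lemma arc_through:
  fixes A1 A2 A3 L1 L2 :: "complex set"
  assumes closed: "closed A1" "closed A2" "closed A3" "closed L1" "closed L2"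
    and disj: "A1 \<inter> A3 = {}" "A1 \<inter> L2 = {}" "L1 \<inter> A3 = {}" "L1 \<inter> L2 \<subseteq> A2"
    and ne: "A1 \<noteq> {}" "A2 \<noteq> {}" "A3 \<noteq> {}"
    and pc: "path_connected (A1 \<union> L1 \<union> A2)" "path_connected (A2 \<union> L2 \<union> A3)"
  obtains g where "arc g" "path_image g \<subseteq> A1 \<union> L1 \<union> A2 \<union> L2 \<union> A3"
    "path_image g \<inter> A1 = {pathstart g}" "path_image g \<inter> A3 = {pathfinish g}"
    "path_image g \<inter> A2 \<noteq> {}"
proof -
  have "path_connected ((A1 \<union> L1 \<union> A2) \<union> (A2 \<union> L2 \<union> A3))"
    using ne by (intro path_connected_Un[OF pc]) auto
  then have U: "path_connected (A1 \<union> L1 \<union> A2 \<union> L2 \<union> A3)"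
    by (simp add: Un_ac)
  obtain x y where xy: "x \<in> A1" "y \<in> A3" using ne by auto
  obtain g where g: "arc g" "path_image g \<subseteq> A1 \<union> L1 \<union> A2 \<union> L2 \<union> A3" "pathstart g \<in> A1"
    "pathfinish g \<in> A3" "g ` {0<..<1} \<inter> (A1 \<union> A3) = {}"
    by (rule arc_between_closed[OF U closed(1,3) disj(1), of x y]) (use xy in auto)
  show thesis
  proof
    show "path_image g \<inter> A1 = {pathstart g}" "path_image g \<inter> A3 = {pathfinish g}"
      unfolding path_image_eq_open_part using g disj(1) by auto
    show "path_image g \<inter> A2 \<noteq> {}"
    proof
      assume A2: "path_image g \<inter> A2 = {}"
      have "connected (path_image g)" using g(1) by (simp add: arc_imp_path connected_path_image)
      moreover have "closed (A1 \<union> L1)" "closed (L2 \<union> A3)" using closed by auto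
      moreover have "path_image g \<subseteq> (A1 \<union> L1) \<union> (L2 \<union> A3)" using g(2) A2 by blast
      moreover have "(A1 \<union> L1) \<inter> (L2 \<union> A3) \<inter> path_image g = {}" using disj A2 by blast
      moreover have "(A1 \<union> L1) \<inter> path_image g \<noteq> {}" "(L2 \<union> A3) \<inter> path_image g \<noteq> {}"
        using g(3,4) pathstart_in_path_image[of g] pathfinish_in_path_image[of g] by auto
      ultimately show False unfolding connected_closed by blast
    qed
  qed (use g in auto)
qed

section \<open>Drawings with continua as vertices\<close>

text \<open>Vertices are drawn as arbitrary path-connected compact sets instead of points, so that drawings can
  be contracted along an edge \<open>uv\<close> by taking \<open>A u \<union> L {u, v} \<union> A v\<close> as the new vertex.\<close>

definition blob_drawing :: "'a set \<Rightarrow> 'a set set \<Rightarrow> ('a \<Rightarrow> complex set) \<Rightarrow> ('a set \<Rightarrow> complex set) \<Rightarrow> bool" where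
  "blob_drawing V E A L \<longleftrightarrow>
     (\<forall>v\<in>V. compact (A v) \<and> path_connected (A v) \<and> A v \<noteq> {}) \<and>
     (\<forall>u\<in>V. \<forall>v\<in>V. u \<noteq> v \<longrightarrow> A u \<inter> A v = {}) \<and>
     (\<forall>e\<in>E. e \<subseteq> V \<and> card e = 2 \<and> compact (L e) \<and> path_connected (L e \<union> \<Union> (A ` e))) \<and>
     (\<forall>e\<in>E. \<forall>v\<in>V - e. L e \<inter> A v = {}) \<and>
     (\<forall>e\<in>E. \<forall>f\<in>E. e \<noteq> f \<longrightarrow> L e \<inter> L f \<subseteq> \<Union> (A ` (e \<inter> f)))"

lemma blob_drawingD:
  assumes "blob_drawing V E A L"
  shows blob_vertex: "v \<in> V \<Longrightarrow> compact (A v) \<and> path_connected (A v) \<and> A v \<noteq> {}"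
    and blob_vertices_disjoint: "u \<in> V \<Longrightarrow> v \<in> V \<Longrightarrow> u \<noteq> v \<Longrightarrow> A u \<inter> A v = {}"
    and blob_edge: "e \<in> E \<Longrightarrow> e \<subseteq> V \<and> card e = 2 \<and> compact (L e) \<and> path_connected (L e \<union> \<Union> (A ` e))"
    and blob_edge_vertex: "e \<in> E \<Longrightarrow> v \<in> V \<Longrightarrow> v \<notin> e \<Longrightarrow> L e \<inter> A v = {}"
    and blob_edges: "e \<in> E \<Longrightarrow> f \<in> E \<Longrightarrow> e \<noteq> f \<Longrightarrow> L e \<inter> L f \<subseteq> \<Union> (A ` (e \<inter> f))"
proof -
  note * = assms[unfolded blob_drawing_def]
  show "v \<in> V \<Longrightarrow> compact (A v) \<and> path_connected (A v) \<and> A v \<noteq> {}"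
    and "u \<in> V \<Longrightarrow> v \<in> V \<Longrightarrow> u \<noteq> v \<Longrightarrow> A u \<inter> A v = {}"
    and "e \<in> E \<Longrightarrow> e \<subseteq> V \<and> card e = 2 \<and> compact (L e) \<and> path_connected (L e \<union> \<Union> (A ` e))"
    and "e \<in> E \<Longrightarrow> v \<in> V \<Longrightarrow> v \<notin> e \<Longrightarrow> L e \<inter> A v = {}"
    and "e \<in> E \<Longrightarrow> f \<in> E \<Longrightarrow> e \<noteq> f \<Longrightarrow> L e \<inter> L f \<subseteq> \<Union> (A ` (e \<inter> f))"
    using * by simp_all
qed

text \<open>The cycle \<open>a b c d\<close> yields a simple closed curve \<open>J\<close>. The link from \<open>a\<close> to \<open>c\<close>, the link from \<open>b\<close> to \<open>d\<close>,
  and the star at \<open>e\<close> are connected and avoid \<open>J\<close>, so two of the three lie on the same side of \<open>J\<close>, and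
  any two of them contain a pair of crossing chords.\<close>

lemma K5_no_blob_drawing:
  assumes dr: "blob_drawing V E A L" and dist: "distinct [a, b, c, d, e]"
    and K5: "\<And>x y. \<lbrakk>x \<in> {a, b, c, d, e}; y \<in> {a, b, c, d, e}; x \<noteq> y\<rbrakk> \<Longrightarrow> {x, y} \<in> E"
  shows False
proof -
  let ?X = "{a, b, c, d, e}"
  have V: "x \<in> V" if "x \<in> ?X" for x
  proof -
    have "x \<noteq> a \<or> x \<noteq> b" using dist by auto
    then have "{x, a} \<in> E \<or> {x, b} \<in> E" using K5 that by blast
    then show ?thesis using blob_edge[OF dr] by blast
  qed
  have cA: "compact (A x)" "path_connected (A x)" "A x \<noteq> {}" "connected (A x)" "closed (A x)" if "x \<in> ?X" for x
    using blob_vertex[OF dr V[OF that]] by (auto intro: path_connected_imp_connected compact_imp_closed)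
  have cL: "closed (L {x, y})" if "x \<in> ?X" "y \<in> ?X" "x \<noteq> y" for x y
    using blob_edge[OF dr K5[OF that]] by (auto intro: compact_imp_closed)
  have pc: "path_connected (A x \<union> L {x, y} \<union> A y)" if "x \<in> ?X" "y \<in> ?X" "x \<noteq> y" for x y
    using blob_edge[OF dr K5[OF that]] by (simp add: Un_ac)
  have AA: "A x \<inter> A y = {}" if "x \<in> ?X" "y \<in> ?X" "x \<noteq> y" for x y
    using blob_vertices_disjoint[OF dr V[OF that(1)] V[OF that(2)] that(3)] .
  have LA: "L {x, y} \<inter> A z = {}" if "x \<in> ?X" "y \<in> ?X" "z \<in> ?X" "x \<noteq> y" "z \<noteq> x" "z \<noteq> y" for x y z
    using blob_edge_vertex[OF dr K5[OF that(1,2,4)] V[OF that(3)]] that(5,6) by simp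
  have LL: "L {x, y} \<inter> L {u, v} \<subseteq> \<Union> (A ` ({x, y} \<inter> {u, v}))"
    if "x \<in> ?X" "y \<in> ?X" "u \<in> ?X" "v \<in> ?X" "x \<noteq> y" "u \<noteq> v" "{x, y} \<noteq> {u, v}" for x y u v
    using blob_edges[OF dr K5[OF that(1,2,5)] K5[OF that(3,4,6)] that(7)] .
  have ne: "a \<noteq> b" "a \<noteq> c" "a \<noteq> d" "a \<noteq> e" "b \<noteq> c" "b \<noteq> d" "b \<noteq> e" "c \<noteq> d" "c \<noteq> e" "d \<noteq> e"
    using dist by auto
  have AA': "A a \<inter> A b = {}" "A a \<inter> A c = {}" "A a \<inter> A d = {}" "A a \<inter> A e = {}" "A b \<inter> A c = {}"
     "A b \<inter> A d = {}" "A b \<inter> A e = {}" "A c \<inter> A d = {}" "A c \<inter> A e = {}" "A d \<inter> A e = {}"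
    by (intro AA; use ne in blast)+
  have LA_a: "L {b, c} \<inter> A a = {}" "L {b, d} \<inter> A a = {}" "L {b, e} \<inter> A a = {}" "L {c, d} \<inter> A a = {}" "L {c, e} \<inter> A a = {}" "L {d, e} \<inter> A a = {}"
   and LA_b: "L {a, c} \<inter> A b = {}" "L {a, d} \<inter> A b = {}" "L {a, e} \<inter> A b = {}" "L {c, d} \<inter> A b = {}" "L {c, e} \<inter> A b = {}" "L {d, e} \<inter> A b = {}"
   and LA_c: "L {a, b} \<inter> A c = {}" "L {a, d} \<inter> A c = {}" "L {a, e} \<inter> A c = {}" "L {b, d} \<inter> A c = {}" "L {b, e} \<inter> A c = {}" "L {d, e} \<inter> A c = {}"
   and LA_d: "L {a, b} \<inter> A d = {}" "L {a, c} \<inter> A d = {}" "L {a, e} \<inter> A d = {}" "L {b, c} \<inter> A d = {}" "L {b, e} \<inter> A d = {}" "L {c, e} \<inter> A d = {}"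
   and LA_e: "L {a, b} \<inter> A e = {}" "L {b, c} \<inter> A e = {}" "L {c, d} \<inter> A e = {}" "L {a, d} \<inter> A e = {}" "L {a, c} \<inter> A e = {}" "L {b, d} \<inter> A e = {}"
    by (intro LA; use ne in blast)+

  have LL_ring: "L {a, b} \<inter> L {b, c} \<subseteq> A b" "L {b, c} \<inter> L {c, d} \<subseteq> A c" "L {c, d} \<inter> L {a, d} \<subseteq> A d"
      "L {a, b} \<inter> L {a, d} \<subseteq> A a" "L {a, b} \<inter> L {c, d} = {}" "L {b, c} \<inter> L {a, d} = {}"
    using LL[of a b b c] LL[of b c c d] LL[of c d a d] LL[of a b a d] LL[of a b c d] LL[of b c a d] ne
    by (simp_all add: doubleton_eq_iff)

  obtain g where g: "arc g" "path_image g \<subseteq> A a \<union> L {a, b} \<union> A b \<union> L {b, c} \<union> A c"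
    "path_image g \<inter> A a = {pathstart g}" "path_image g \<inter> A c = {pathfinish g}"
    "path_image g \<inter> A b \<noteq> {}"
    by (rule arc_through[of "A a" "A b" "A c" "L {a, b}" "L {b, c}"])
      (use cA cL pc AA' LA_a LA_c LL_ring ne in \<open>simp_all add: Int_commute\<close>)
  obtain h where h: "arc h" "path_image h \<subseteq> A c \<union> L {c, d} \<union> A d \<union> L {a, d} \<union> A a"
    "path_image h \<inter> A c = {pathstart h}" "path_image h \<inter> A a = {pathfinish h}"
    "path_image h \<inter> A d \<noteq> {}"
    by (rule arc_through[of "A c" "A d" "A a" "L {c, d}" "L {a, d}"])
      (use cA cL pc[of c d] pc[of a d] AA' LA_a LA_c LL_ring ne in \<open>simp_all add: Int_commute Un_ac\<close>)

  \<comment> \<open>\<open>g\<close> and \<open>h\<close> may meet \<open>A a\<close> in different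
    points, and likewise \<open>A c\<close>. The tails \<open>Ka\<close> and \<open>Kc\<close>
    inside these two sets close the gaps.\<close>
  obtain h' Ka where h': "arc h'" "pathstart h' = pathstart h" "pathfinish h' = pathstart g"
    "path_image h' = path_image h \<union> Ka" 
    and Ka: "compact Ka" "connected Ka" "Ka \<subseteq> A a" "pathstart g \<in> Ka" "pathfinish h \<in> Ka"
    using g(3) cA(2)[of a] by (auto intro: arc_extend_into[OF h(1) _ h(4), of "pathstart g"])
  have "path_image (reversepath h') \<inter> A c = {pathfinish (reversepath h')}"
    using h'(2,4) Ka(3) h(3) AA'(2) by auto
  then obtain k Kc where k: "arc k" "pathstart k = pathstart (reversepath h')" "pathfinish k = pathfinish g"
    "path_image k = path_image (reversepath h') \<union> Kc"
    and Kc: "compact Kc" "connected Kc" "Kc \<subseteq> A c" "pathfinish g \<in> Kc" "pathfinish (reversepath h') \<in> Kc"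
    by (rule arc_extend_into[of "reversepath h'" "A c" "pathfinish g", rotated 2])
      (use g(4) cA(2)[of c] h'(1) in \<open>auto simp: arc_reversepath\<close>)
  have k': "pathstart k = pathstart g" "path_image k = path_image h \<union> Ka \<union> Kc"
    using k h' by auto

  \<comment> \<open>The curve consists of the side \<open>S\<close> through \<open>b\<close>, the
    side \<open>T\<close> through \<open>d\<close>, and the part \<open>K\<close> inside
    \<open>A a\<close> and \<open>A c\<close>. The sides overlap only in \<open>K\<close>, as the
    crossing argument demands.\<close>
  define S T K where "S = path_image g" and "T = path_image h" and "K = Ka \<union> Kc"
  define J where "J = path_image (g +++ reversepath k)"
  have J: "J = K \<union> S \<union> T"
    using k(3) k' g(1) by (auto simp: J_def S_def T_def K_def path_image_join)
  have "(A a \<union> L {a, b} \<union> A b \<union> L {b, c} \<union> A c) \<inter> (A c \<union> L {c, d} \<union> A d \<union> L {a, d} \<union> A a) \<subseteq> A a \<union> A c"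
    using LL_ring(2,4,5,6) LA_d(1,4) AA'(6) LA_b(2,4) by blast
  then have ST: "S \<inter> T \<subseteq> A a \<union> A c" using g(2) h(2) unfolding S_def T_def by blast
  have SK: "S \<inter> A a = {pathstart g}" "S \<inter> A c = {pathfinish g}" "{pathstart g, pathfinish g} \<subseteq> K"
    using g(3,4) Ka(4) Kc(4) by (simp_all add: S_def K_def)
  then have ST': "S \<inter> T \<subseteq> K" using ST by blast
  have "path_image g \<inter> path_image k = S \<inter> (T \<union> Ka \<union> Kc)" by (simp add: S_def T_def k')
  also have "\<dots> \<subseteq> (S \<inter> A a) \<union> (S \<inter> A c)" using ST Ka(3) Kc(3) by blast
  finally have "path_image g \<inter> path_image k \<subseteq> {pathstart g, pathfinish g}"
    unfolding SK by (simp add: insert_commute)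
  then have sp: "simple_path (g +++ reversepath k)"
    using g(1) k(1,3) k' by (intro simple_path_join_loop) (auto simp: arc_reversepath)
  have "pathfinish (g +++ reversepath k) = pathstart (g +++ reversepath k)" using k' by simp
  note Jordan = Jordan_inside_outside[OF sp this, folded J_def]
  have cpt: "compact S" "compact T" "compact K"
    using g(1) h(1) Ka(1) Kc(1) by (auto simp: S_def T_def K_def arc_imp_path compact_path_image)

  have gA: "S \<inter> A d = {}" "S \<inter> A e = {}" "S \<inter> A b \<noteq> {}"
  proof -
    show "S \<inter> A d = {}" using g(2) AA'(3,6,8) LA_d(1,4) unfolding S_def by blast
    show "S \<inter> A e = {}" using g(2) AA'(4,7,9) LA_e(1,2) unfolding S_def by blast
    show "S \<inter> A b \<noteq> {}" using g(5) unfolding S_def .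
  qed
  have hA: "T \<inter> A b = {}" "T \<inter> A e = {}" "T \<inter> A d \<noteq> {}"
  proof -
    show "T \<inter> A b = {}" using h(2) AA'(1,5,6) LA_b(2,4) unfolding T_def by blast
    show "T \<inter> A e = {}" using h(2) AA'(4,9,10) LA_e(3,4) unfolding T_def by blast
    show "T \<inter> A d \<noteq> {}" using h(5) unfolding T_def .
  qed
  have KA: "K \<inter> A b = {}" "K \<inter> A d = {}" "K \<inter> A e = {}"
  proof -
    show "K \<inter> A b = {}" using Ka(3) Kc(3) AA'(1,5) unfolding K_def by blast
    show "K \<inter> A d = {}" using Ka(3) Kc(3) AA'(3,8) unfolding K_def by blast
    show "K \<inter> A e = {}" using Ka(3) Kc(3) AA'(4,9) unfolding K_def by blast
  qed
  have TK: "T \<inter> A a \<subseteq> Ka" "T \<inter> A c \<subseteq> Kc"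
    using h(3,4) h'(2) Ka(5) Kc(5) by (simp_all add: T_def)
  have Ja: "J \<inter> A a = Ka"
  proof -
    have "S \<inter> A a \<subseteq> Ka" using SK(1) Ka(4) by simp
    then show ?thesis using TK(1) Ka(3) Kc(3) AA'(2) unfolding J K_def by blast
  qed
  have Jc: "J \<inter> A c = Kc"
  proof -
    have "S \<inter> A c \<subseteq> Kc" using SK(2) Kc(4) by simp
    then show ?thesis using TK(2) Ka(3) Kc(3) AA'(2) unfolding J K_def by blast
  qed
  have Jb: "J \<inter> A b = S \<inter> A b" and Jd: "J \<inter> A d = T \<inter> A d" and Je: "J \<inter> A e = {}"
    unfolding J using gA hA KA by blast+
  have clJ: "closed J" unfolding J using cpt[THEN compact_imp_closed] by (simp add: closed_Un)

  \<comment> \<open>\<open>J\<close> is covered by the four rim vertices and the four rim links, so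
    bounding an intersection with \<open>J\<close> amounts to eight checks.\<close>
  have JL: "J \<inter> M \<subseteq> N"
    if "A a \<inter> M \<subseteq> N" "A b \<inter> M \<subseteq> N" "A c \<inter> M \<subseteq> N" "A d \<inter> M \<subseteq> N"
      "L {a, b} \<inter> M \<subseteq> N" "L {b, c} \<inter> M \<subseteq> N" "L {c, d} \<inter> M \<subseteq> N" "L {a, d} \<inter> M \<subseteq> N" for M N
  proof -
    let ?R = "A a \<union> A b \<union> A c \<union> A d \<union> L {a, b} \<union> L {b, c} \<union> L {c, d} \<union> L {a, d}"
    have "K \<subseteq> ?R" using Ka(3) Kc(3) unfolding K_def by blast
    moreover have "S \<subseteq> ?R" using g(2) unfolding S_def by blast
    moreover have "T \<subseteq> ?R" using h(2) unfolding T_def by blast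
    ultimately have "J \<inter> M \<subseteq> ?R \<inter> M" unfolding J by auto
    also have "\<dots> \<subseteq> N" using that by (simp add: Int_Un_distrib2)
    finally show ?thesis .
  qed
  have JLxy: "J \<inter> L {x, y} \<subseteq> A x \<union> A y"
    if xy: "x \<in> ?X" "y \<in> ?X" "x \<noteq> y" and nr: "{a, b} \<noteq> {x, y}" "{b, c} \<noteq> {x, y}" "{c, d} \<noteq> {x, y}" "{a, d} \<noteq> {x, y}" for x y
  proof -
    have 1: "A z \<inter> L {x, y} \<subseteq> A x \<union> A y" if "z \<in> ?X" for z
      using LA[OF xy(1,2) that xy(3)] by blast
    have 2: "L {z, w} \<inter> L {x, y} \<subseteq> A x \<union> A y" if "z \<in> ?X" "w \<in> ?X" "z \<noteq> w" "{z, w} \<noteq> {x, y}" for z w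
      using LL[OF that(1,2) xy(1,2) that(3) xy(3) that(4)] by blast
    show ?thesis
      by (rule JL; (rule 1 | rule 2); (rule nr)?; simp add: ne)
  qed

  \<comment> \<open>\<open>C\<close> bridges the two pieces of \<open>K\<close>, at \<open>a\<close>
    and at \<open>c\<close>, while \<open>D\<close> touches \<open>J\<close> at \<open>b\<close> and
    at \<open>d\<close>. Two such disjoint chords cannot both stay off the same side
    \<open>W\<close>.\<close>
  have cross: False
    if W: "W \<in> {inside J, outside J}"
      and c: "compact C" "connected (C \<union> K)" "C \<inter> W = {}" "C \<inter> A b = {}" "C \<inter> A d = {}"
      and D: "connected D" "D \<inter> W = {}" "D \<inter> J = {}" "D \<inter> C = {}"
      and qs: "q \<in> J \<inter> A b" "q \<in> closure D" "s \<in> J \<inter> A d" "s \<in> closure D" for C D W q s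
  proof (rule crossing_chords[OF J cpt(3,1,2) c(1) ST' c(2) _ _ c(3) D])
    show "W \<in> components (- J)"
      using W Jordan by (auto simp: inside_in_components outside_in_components)
    have "frontier W = J" using W Jordan by auto
    then show "J \<subseteq> closure W" by (auto simp: frontier_def)
    show "q \<in> S" "s \<in> T" using qs Jb Jd by auto
    show "q \<notin> C \<union> K \<union> T" using qs(1) c(4) KA(1) hA(1) by auto
    show "s \<notin> C \<union> K \<union> S" using qs(3) c(5) KA(2) gA(1) by auto
  qed (use qs in auto)
  have side: "D \<inter> inside J = {} \<or> D \<inter> outside J = {}" if "connected D" "D \<inter> J = {}" for D
  proof -
    have "D \<subseteq> inside J \<union> outside J" using Jordan that(2) by auto
    then show ?thesis
      using connectedD[OF that(1), of "inside J" "outside J"] Jordan by auto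
  qed
  have JW: "J \<inter> W = {}" if "W \<in> {inside J, outside J}" for W
    using that inside_no_overlap[of J] outside_no_overlap[of J] by (auto simp: Int_commute)

  \<comment> \<open>A barrier has to be compact and a crossing set has to avoid \<open>J\<close>, so
    each chord comes in two versions: \<open>C\<close> with its end points on \<open>J\<close>,
    \<open>D\<close> without them.\<close>
  have chord: "\<exists>C D p q. compact C \<and> connected C \<and> connected D \<and> C = insert p (insert q D) \<and>
      C \<subseteq> A x \<union> L {x, y} \<union> A y \<and> p \<in> J \<inter> A x \<and> q \<in> J \<inter> A y \<and> D \<inter> J = {} \<and> p \<in> closure D \<and> q \<in> closure D"
    if xy: "x \<in> ?X" "y \<in> ?X" "x \<noteq> y" and nr: "{a, b} \<noteq> {x, y}" "{b, c} \<noteq> {x, y}" "{c, d} \<noteq> {x, y}" "{a, d} \<noteq> {x, y}"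
      and ne: "J \<inter> A x \<noteq> {}" "J \<inter> A y \<noteq> {}" for x y
  proof -
    obtain p q where pq: "p \<in> J \<inter> A x" "q \<in> J \<inter> A y" using ne by auto
    obtain f where f: "arc f" "path_image f \<subseteq> A x \<union> L {x, y} \<union> A y" "pathstart f \<in> J \<inter> A x"
      "pathfinish f \<in> J \<inter> A y" "f ` {0<..<1} \<inter> (J \<inter> A x \<union> J \<inter> A y) = {}"
    proof (rule arc_between_closed[OF pc[OF xy], of "J \<inter> A x" "J \<inter> A y" p q])
      show "(J \<inter> A x) \<inter> (J \<inter> A y) = {}" using AA[OF xy] by blast
    qed (use pq cA(5)[OF xy(1)] cA(5)[OF xy(2)] clJ in \<open>simp_all add: closed_Int\<close>)
    let ?D = "f ` {0<..<1}"
    have f': "path_image f = insert (pathstart f) (insert (pathfinish f) ?D)"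
      by (rule path_image_eq_open_part)
    moreover have "?D \<inter> J = {}" using f' f(2,5) JLxy[OF xy nr] by blast
    moreover have "pathstart f \<in> closure ?D" "pathfinish f \<in> closure ?D" "connected ?D"
      using path_open_part[OF arc_imp_path[OF f(1)]] f' by auto
    moreover have "compact (path_image f)" "connected (path_image f)"
      using f(1) by (auto simp: arc_imp_path compact_path_image connected_path_image)
    ultimately show ?thesis using f(2,3,4) by metis
  qed
  \<comment> \<open>Here \<open>D\<close> keeps the end point in \<open>A e\<close>, which does not
    lie on \<open>J\<close>; there the spokes can be glued together.\<close>
  have spoke: "\<exists>C D p. compact C \<and> connected C \<and> connected D \<and> C = insert p D \<and>
      C \<subseteq> A x \<union> L {x, e} \<union> A e \<and> p \<in> J \<inter> A x \<and> D \<inter> A e \<noteq> {} \<and> D \<inter> J = {} \<and> p \<in> closure D"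
    if x: "x \<in> {a, b, c, d}" and Jx: "J \<inter> A x \<noteq> {}" for x
  proof -
    have xe: "x \<in> ?X" "e \<in> ?X" "x \<noteq> e"
        "{a, b} \<noteq> {x, e}" "{b, c} \<noteq> {x, e}" "{c, d} \<noteq> {x, e}" "{a, d} \<noteq> {x, e}"
      using x ne by (auto simp: doubleton_eq_iff)
    obtain p q where pq: "p \<in> J \<inter> A x" "q \<in> A e" using Jx cA(3)[of e] by auto
    obtain f where f: "arc f" "path_image f \<subseteq> A x \<union> L {x, e} \<union> A e" "pathstart f \<in> J \<inter> A x"
      "pathfinish f \<in> A e" "f ` {0<..<1} \<inter> (J \<inter> A x \<union> A e) = {}"
    proof (rule arc_between_closed[OF pc[OF xe(1-3)], of "J \<inter> A x" "A e" p q])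
      show "(J \<inter> A x) \<inter> A e = {}" using AA[OF xe(1-3)] by blast
    qed (use pq cA(5)[OF xe(1)] cA(5)[OF xe(2)] clJ in \<open>simp_all add: closed_Int\<close>)
    let ?D = "insert (pathfinish f) (f ` {0<..<1})"
    have f': "path_image f = insert (pathstart f) ?D"
      by (rule path_image_eq_open_part)
    have o: "connected (f ` {0<..<1})" "path_image f \<subseteq> closure (f ` {0<..<1})"
      using path_open_part[OF arc_imp_path[OF f(1)]] by auto
    have "connected ?D"
      by (rule connected_intermediate_closure[OF o(1)]) (use o(2) f' closure_subset in auto)
    moreover have "pathstart f \<in> closure ?D"
      using o(2) f' closure_mono[of "f ` {0<..<1}" ?D] by auto
    moreover have "?D \<inter> J = {}"
      using f' f(2,4,5) JLxy[OF xe] Je by blast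
    moreover have "compact (path_image f)" "connected (path_image f)"
      using f(1) by (auto simp: arc_imp_path compact_path_image connected_path_image)
    moreover have "?D \<inter> A e \<noteq> {}" using f(4) by auto
    ultimately show ?thesis using f(2,3) f' by metis
  qed

  have K_ne: "J \<inter> A a \<noteq> {}" "J \<inter> A b \<noteq> {}" "J \<inter> A c \<noteq> {}" "J \<inter> A d \<noteq> {}"
    using Ka(4) Kc(4) gA(3) hA(3) unfolding Ja Jb Jc Jd by auto
  have X: "a \<in> ?X" "b \<in> ?X" "c \<in> ?X" "d \<in> ?X"
    and Y: "a \<in> {a, b, c, d}" "b \<in> {a, b, c, d}" "c \<in> {a, b, c, d}" "d \<in> {a, b, c, d}" by simp_all
  have nr: "{a, b} \<noteq> {a, c}" "{b, c} \<noteq> {a, c}" "{c, d} \<noteq> {a, c}" "{a, d} \<noteq> {a, c}"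
      "{a, b} \<noteq> {b, d}" "{b, c} \<noteq> {b, d}" "{c, d} \<noteq> {b, d}" "{a, d} \<noteq> {b, d}"
    using ne by (simp_all add: doubleton_eq_iff)
  obtain C1 D1 p1 q1 where 1: "compact C1" "connected C1" "connected D1" "C1 = insert p1 (insert q1 D1)"
    "C1 \<subseteq> A a \<union> L {a, c} \<union> A c" "p1 \<in> J \<inter> A a" "q1 \<in> J \<inter> A c" "D1 \<inter> J = {}"
    using chord[OF X(1,3) ne(2) nr(1-4) K_ne(1,3)] by (elim exE conjE) (rule that)
  obtain C2 D2 p2 q2 where 2: "connected D2" "C2 = insert p2 (insert q2 D2)"
    "C2 \<subseteq> A b \<union> L {b, d} \<union> A d" "p2 \<in> J \<inter> A b" "q2 \<in> J \<inter> A d" "D2 \<inter> J = {}"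
    "p2 \<in> closure D2" "q2 \<in> closure D2"
    using chord[OF X(2,4) ne(6) nr(5-8) K_ne(2,4)] by (elim exE conjE) (rule that)
  obtain Ca Da pa where sa: "compact Ca" "connected Ca" "connected Da" "Ca = insert pa Da"
      "Ca \<subseteq> A a \<union> L {a, e} \<union> A e" "pa \<in> J \<inter> A a" "Da \<inter> A e \<noteq> {}" "Da \<inter> J = {}"
    using spoke[OF Y(1) K_ne(1)] by (elim exE conjE) (rule that)
  obtain Cb Db pb where sb: "connected Db" "Cb = insert pb Db"
      "Cb \<subseteq> A b \<union> L {b, e} \<union> A e" "pb \<in> J \<inter> A b" "Db \<inter> A e \<noteq> {}" "Db \<inter> J = {}" "pb \<in> closure Db"
    using spoke[OF Y(2) K_ne(2)] by (elim exE conjE) (rule that)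
  obtain Cc Dc pc' where sc: "compact Cc" "connected Cc" "connected Dc" "Cc = insert pc' Dc"
      "Cc \<subseteq> A c \<union> L {c, e} \<union> A e" "pc' \<in> J \<inter> A c" "Dc \<inter> A e \<noteq> {}" "Dc \<inter> J = {}"
    using spoke[OF Y(3) K_ne(3)] by (elim exE conjE) (rule that)
  obtain Cd Dd pd where sd: "connected Dd" "Cd = insert pd Dd"
      "Cd \<subseteq> A d \<union> L {d, e} \<union> A e" "pd \<in> J \<inter> A d" "Dd \<inter> A e \<noteq> {}" "Dd \<inter> J = {}" "pd \<in> closure Dd"
    using spoke[OF Y(4) K_ne(4)] by (elim exE conjE) (rule that)
  \<comment> \<open>Via the hub, \<open>C3\<close> is a second chord from \<open>a\<close> to
    \<open>c\<close>, and \<open>D3\<close> one from \<open>b\<close> to \<open>d\<close>.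
    \<open>H\<close> is the whole star off \<open>J\<close>, so a side of \<open>J\<close> avoided
    by \<open>H\<close> is avoided by both.\<close>
  define C3 where "C3 = Ca \<union> A e \<union> Cc"
  define D3 where "D3 = Db \<union> A e \<union> Dd"
  define H where "H = D3 \<union> (Da \<union> A e \<union> Dc)"
  have conn_e: "connected (X \<union> A e \<union> Y)" if "connected X" "connected Y" "X \<inter> A e \<noteq> {}" "Y \<inter> A e \<noteq> {}" for X Y
    using that cA(4)[of e] by (intro connected_Un) auto
  have conn: "connected C3" "connected D3" "connected H"
  proof -
    show C: "connected C3" unfolding C3_def using sa sc by (intro conn_e) auto
    show D: "connected D3" unfolding D3_def using sb sd by (intro conn_e) auto
    have "connected (Da \<union> A e \<union> Dc)" using sa sc by (intro conn_e) auto
    moreover have "D3 \<inter> (Da \<union> A e \<union> Dc) \<noteq> {}" using cA(3)[of e] unfolding D3_def by auto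
    ultimately show "connected H" unfolding H_def by (rule connected_Un[OF D])
  qed
  have HJ: "H \<inter> J = {}" unfolding H_def D3_def using sa(8) sb(6) sc(8) sd(6) Je by auto
  have LL_X: "L {a, c} \<inter> L {b, d} = {}" "L {a, e} \<inter> L {b, d} = {}" "L {c, e} \<inter> L {b, d} = {}"
      "L {a, c} \<inter> L {b, e} = {}" "L {a, c} \<inter> L {d, e} = {}"
    using LL[of a c b d] LL[of a e b d] LL[of c e b d] LL[of a c b e] LL[of a c d e] ne
    by (simp_all add: doubleton_eq_iff)
  have C1: "C1 \<inter> A b = {}" "C1 \<inter> A d = {}"
  proof -
    show "C1 \<inter> A b = {}" using 1(5) AA'(1,5) LA_b(1) by blast
    show "C1 \<inter> A d = {}" using 1(5) AA'(3,8) LA_d(2) by blast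
  qed
  have "C3 \<subseteq> A a \<union> L {a, e} \<union> A e \<union> L {c, e} \<union> A c" unfolding C3_def using sa(5) sc(5) by blast
  note C3s = this
  have C3: "C3 \<inter> A b = {}" "C3 \<inter> A d = {}"
  proof -
    show "C3 \<inter> A b = {}" using C3s AA'(1,5,7) LA_b(3,5) by blast
    show "C3 \<inter> A d = {}" using C3s AA'(3,8,10) LA_d(3,6) by blast
  qed
  have D2s: "D2 \<subseteq> A b \<union> L {b, d} \<union> A d" using 2(2,3) by auto
  have D3s: "D3 \<subseteq> A b \<union> L {b, e} \<union> A e \<union> L {d, e} \<union> A d"
  proof -
    have "Db \<subseteq> Cb" "Dd \<subseteq> Cd" using sb(2) sd(2) by auto
    then show ?thesis unfolding D3_def using sb(3) sd(3) by blast
  qed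
  have D2C1: "D2 \<inter> C1 = {}"
  proof -
    show ?thesis using C1 D2s 1(5) LL_X(1) LA_a(2) LA_c(4) by blast
  qed
  have D2C3: "D2 \<inter> C3 = {}"
    using C3 D2s C3s LL_X(2,3) LA_a(2) LA_c(4) LA_e(6) by blast
  have D3C1: "D3 \<inter> C1 = {}"
  proof -
    have "C1 \<inter> L {b, e} = {}" using 1(5) LL_X(4) LA_a(3) LA_c(5) by blast
    moreover have "C1 \<inter> L {d, e} = {}" using 1(5) LL_X(5) LA_a(6) LA_c(6) by blast
    moreover have "C1 \<inter> A e = {}" using 1(5) LA_e(5) AA'(4,9) by blast
    ultimately show ?thesis using C1 D3s by blast
  qed

  have KA_conn: "connected (C \<union> K)" if "connected C" "p \<in> C \<inter> Ka" "q \<in> C \<inter> Kc" for C p q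
  proof -
    have "connected (C \<union> Ka)" using connected_Un[OF that(1) Ka(2)] that(2) by auto
    then have "connected ((C \<union> Ka) \<union> Kc)" by (rule connected_Un[OF _ Kc(2)]) (use that in auto)
    then show ?thesis by (simp add: K_def Un_assoc)
  qed
  have conn_K: "connected (C1 \<union> K)" "connected (C3 \<union> K)"
  proof -
    show "connected (C1 \<union> K)"
      by (rule KA_conn[OF 1(2), of p1 q1]) (use 1(4,6,7) Ja Jc in auto)
    show "connected (C3 \<union> K)"
      by (rule KA_conn[OF conn(1), of pa pc']) (use sa(4,6) sc(4,6) Ja Jc in \<open>auto simp: C3_def\<close>)
  qed
  have C3c: "compact C3" unfolding C3_def using sa(1) sc(1) cA(1)[of e] by (intro compact_Un) auto

  have "\<exists>W\<in>{inside J, outside J}. D1 \<inter> W = {} \<and> D2 \<inter> W = {} \<or> D1 \<inter> W = {} \<and> H \<inter> W = {} \<or> D2 \<inter> W = {} \<and> H \<inter> W = {}"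
    using side[OF 1(3,8)] side[OF 2(1,6)] side[OF conn(3) HJ] by blast
  then obtain W where W: "W \<in> {inside J, outside J}"
    and WW: "D1 \<inter> W = {} \<and> D2 \<inter> W = {} \<or> D1 \<inter> W = {} \<and> H \<inter> W = {} \<or> D2 \<inter> W = {} \<and> H \<inter> W = {}"
    by blast
  have C1W: "C1 \<inter> W = {}" if "D1 \<inter> W = {}"
    using that JW[OF W] 1(4,6,7) by blast
  have C3W: "C3 \<inter> W = {}" if "H \<inter> W = {}"
    using that JW[OF W] sa(4,6) sc(4,6) unfolding C3_def H_def by blast
  have D3W: "D3 \<inter> W = {}" if "H \<inter> W = {}" using that unfolding H_def by blast
  have D3J: "D3 \<inter> J = {}" using HJ unfolding H_def by blast
  have cl3: "pb \<in> closure D3" "pd \<in> closure D3"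
    using sb(7) sd(7) closure_mono[of Db D3] closure_mono[of Dd D3] unfolding D3_def by auto
  \<comment> \<open>The barrier and the crossing set are \<open>C1\<close> and \<open>D2\<close>,
    then \<open>C1\<close> and \<open>D3\<close> (the hub crosses), then \<open>C3\<close> and
    \<open>D2\<close> (the hub is the barrier).\<close>
  from WW show False
  proof (elim disjE conjE)
    assume "D1 \<inter> W = {}" "D2 \<inter> W = {}"
    then show False
      using cross[OF W 1(1) conn_K(1) C1W C1 2(1) _ 2(6) D2C1 2(4,7,5,8)] by blast
  next
    assume "D1 \<inter> W = {}" "H \<inter> W = {}"
    then show False
      using cross[OF W 1(1) conn_K(1) C1W C1 conn(2) D3W D3J D3C1 sb(4) cl3(1) sd(4) cl3(2)] by blast
  next
    assume "D2 \<inter> W = {}" "H \<inter> W = {}"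
    then show False
      using cross[OF W C3c conn_K(2) C3W C3 2(1) _ 2(6) D2C3 2(4,7,5,8)] by blast
  qed
qed

section \<open>Subgraphs and contractions of drawings\<close>

lemma blob_drawing_mono:
  assumes "blob_drawing V E A L" "V' \<subseteq> V" "E' \<subseteq> E" "\<Union>E' \<subseteq> V'"
  shows "blob_drawing V' E' A L"
  unfolding blob_drawing_def
proof (intro conjI ballI impI)
  fix e v assume "e \<in> E'" "v \<in> V' - e"
  then show "L e \<inter> A v = {}" using blob_edge_vertex[OF assms(1)] assms(2,3) by blast
next
  fix e f assume "e \<in> E'" "f \<in> E'" "e \<noteq> f"
  then show "L e \<inter> L f \<subseteq> \<Union> (A ` (e \<inter> f))"
    using assms(3) by (intro blob_edges[OF assms(1)]) auto
next
  fix u v assume "u \<in> V'" "v \<in> V'" "u \<noteq> v"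
  then show "A u \<inter> A v = {}"
    using assms(2) by (intro blob_vertices_disjoint[OF assms(1)]) auto
qed (use blob_vertex[OF assms(1)] blob_edge[OF assms(1)] assms(2-4) in blast)+

text \<open>The edges from \<open>u\<close> and \<open>v\<close> to a common neighbour become the
  same edge. Of the links competing for it, \<open>\<rho>\<close> selects one by choosing a
  preimage. Links are never redrawn; only the vertex \<open>u\<close> grows.\<close>

lemma blob_drawing_contract:
  assumes dr: "blob_drawing V E A L" and uv: "{u, v} \<in> E"
  shows "\<exists>A' L'. blob_drawing (V - {v}) ((`) (id(v := u)) ` (E - {{u, v}})) A' L'"
proof -
  define \<pi> where "\<pi> = id(v := u)"
  define A' where "A' = A(u := A u \<union> L {u, v} \<union> A v)"
  define \<rho> where "\<rho> = inv_into (E - {{u, v}}) ((`) \<pi>)"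
  have ne: "u \<noteq> v" and V: "u \<in> V" "v \<in> V" using blob_edge[OF dr uv] by auto
  have \<pi>: "\<pi> v = u" "\<And>x. x \<noteq> v \<Longrightarrow> \<pi> x = x" by (auto simp: \<pi>_def)
  have AA': "A x \<subseteq> A' (\<pi> x)" for x by (auto simp: \<pi>_def A'_def)
  have uvA: "compact (A' u)" "path_connected (A' u)" "A' u \<noteq> {}"
    using blob_edge[OF dr uv] blob_vertex[OF dr V(1)] blob_vertex[OF dr V(2)]
    by (auto simp: A'_def Un_ac)
  have \<rho>: "\<rho> e \<in> E" "\<rho> e \<noteq> {u, v}" "\<pi> ` \<rho> e = e" if "e \<in> (`) \<pi> ` (E - {{u, v}})" for e
    using inv_into_into[OF that] f_inv_into_f[OF that] unfolding \<rho>_def by auto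
  \<comment> \<open>At most one end of a remaining edge belongs to the merged pair. Naming the ends
    so that it can only be \<open>x\<close> leaves the continuum of \<open>w\<close>
    unchanged.\<close>
  have shape: "\<exists>x w. e = {x, w} \<and> x \<noteq> w \<and> w \<notin> {u, v} \<and> x \<in> V \<and> w \<in> V" if e: "e \<in> E" "e \<noteq> {u, v}" for e
  proof -
    obtain x w where xw: "e = {x, w}" "x \<noteq> w" "x \<in> V" "w \<in> V"
      using blob_edge[OF dr e(1)] by (auto simp: card_2_iff)
    then have "w \<notin> {u, v} \<or> x \<notin> {u, v}" using e(2) by auto
    then show ?thesis using xw by (metis insert_commute)
  qed
  have "blob_drawing (V - {v}) ((`) \<pi> ` (E - {{u, v}})) A' (L \<circ> \<rho>)"
    unfolding blob_drawing_def
  proof (intro conjI ballI impI)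
    fix x assume "x \<in> V - {v}"
    then show "compact (A' x)" "path_connected (A' x)" "A' x \<noteq> {}"
      using uvA blob_vertex[OF dr, of x] by (auto simp: A'_def split: if_splits)
  next
    fix x y assume xy: "x \<in> V - {v}" "y \<in> V - {v}" "x \<noteq> y"
    then have "x \<notin> {u, v} \<or> y \<notin> {u, v}" by auto
    moreover have "A z \<inter> A' u = {}" if "z \<in> V" "z \<notin> {u, v}" for z
      using blob_vertices_disjoint[OF dr that(1) V(1)] blob_vertices_disjoint[OF dr that(1) V(2)]
        blob_edge_vertex[OF dr uv that] that(2) unfolding A'_def by auto
    ultimately show "A' x \<inter> A' y = {}"
      using xy blob_vertices_disjoint[OF dr, of x y] by (auto simp: A'_def split: if_splits)
  next
    fix e assume e: "e \<in> (`) \<pi> ` (E - {{u, v}})"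
    obtain x w where xw: "\<rho> e = {x, w}" "x \<noteq> w" "w \<notin> {u, v}" "x \<in> V" "w \<in> V"
      using shape[OF \<rho>(1,2)[OF e]] by blast
    then have ex: "e = {\<pi> x, w}" using \<rho>(3)[OF e] \<pi>(2) by auto
    have "\<pi> x \<in> V - {v}" "\<pi> x \<noteq> w" using xw(2-4) V ne by (auto simp: \<pi>_def)
    then show "e \<subseteq> V - {v}" "card e = 2" using xw(3,5) by (simp_all add: ex)
    show "compact ((L \<circ> \<rho>) e)" using blob_edge[OF dr \<rho>(1)[OF e]] by simp
    have "path_connected (A' (\<pi> x))"
    proof (cases "x \<in> {u, v}")
      case True
      then have "\<pi> x = u" using \<pi>(1) \<pi>(2)[OF ne] by auto
      then show ?thesis using uvA(2) by simp
    next
      case False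
      then show ?thesis using blob_vertex[OF dr xw(4)] by (simp add: A'_def \<pi>_def)
    qed
    moreover have "path_connected (L (\<rho> e) \<union> \<Union> (A ` \<rho> e))"
      using blob_edge[OF dr \<rho>(1)[OF e]] by simp
    moreover have "(L (\<rho> e) \<union> \<Union> (A ` \<rho> e)) \<inter> A' (\<pi> x) \<noteq> {}"
      using blob_vertex[OF dr xw(4)] AA'[of x] xw(1) by auto
    ultimately have "path_connected ((L (\<rho> e) \<union> \<Union> (A ` \<rho> e)) \<union> A' (\<pi> x))"
      by (metis path_connected_Un)
    moreover have "(L (\<rho> e) \<union> \<Union> (A ` \<rho> e)) \<union> A' (\<pi> x) = L (\<rho> e) \<union> \<Union> (A' ` e)"
    proof -
      have "A' w = A w" using xw(3) by (simp add: A'_def)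
      then have "\<Union> (A' ` e) = A' (\<pi> x) \<union> A w" by (subst ex) simp
      then show ?thesis using AA'[of x] xw(1) by auto
    qed
    ultimately show "path_connected ((L \<circ> \<rho>) e \<union> \<Union> (A' ` e))" by simp
  next
    fix e k assume e: "e \<in> (`) \<pi> ` (E - {{u, v}})" and k: "k \<in> V - {v} - e"
    have "\<pi> k = k" using k \<pi>(2) by auto
    then have k': "k \<notin> \<rho> e" using k \<rho>(3)[OF e] by (metis DiffD2 image_eqI)
    show "(L \<circ> \<rho>) e \<inter> A' k = {}"
    proof (cases "k = u")
      case False
      then show ?thesis using blob_edge_vertex[OF dr \<rho>(1)[OF e]] k k' by (auto simp: A'_def)
    next
      case True
      \<comment> \<open>The preimage of \<open>e\<close> avoids both \<open>u\<close> and
        \<open>v\<close>, so its link misses all three pieces of the new vertex: \<open>A u\<close>,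
        \<open>A v\<close> and, having no end in common with \<open>{u, v}\<close>, also
        \<open>L {u, v}\<close>.\<close>
      then have v: "v \<notin> \<rho> e" using k \<rho>(3)[OF e] \<pi>(1) by (metis DiffD2 image_eqI)
      have "L (\<rho> e) \<inter> L {u, v} \<subseteq> \<Union> (A ` (\<rho> e \<inter> {u, v}))"
        by (rule blob_edges[OF dr \<rho>(1)[OF e] uv \<rho>(2)[OF e]])
      also have "\<rho> e \<inter> {u, v} = {}" using v k' True by auto
      finally show ?thesis
        using blob_edge_vertex[OF dr \<rho>(1)[OF e] V(2) v] blob_edge_vertex[OF dr \<rho>(1)[OF e] V(1)] k' True
        by (auto simp: A'_def)
    qed
  next
    fix e f assume e: "e \<in> (`) \<pi> ` (E - {{u, v}})" and f: "f \<in> (`) \<pi> ` (E - {{u, v}})" and ef: "e \<noteq> f"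
    then have "\<rho> e \<noteq> \<rho> f" using \<rho>(3) by metis
    then have "L (\<rho> e) \<inter> L (\<rho> f) \<subseteq> \<Union> (A ` (\<rho> e \<inter> \<rho> f))"
      by (rule blob_edges[OF dr \<rho>(1)[OF e] \<rho>(1)[OF f]])
    also have "\<dots> \<subseteq> \<Union> (A' ` (\<pi> ` (\<rho> e \<inter> \<rho> f)))" using AA' by blast
    also have "\<dots> \<subseteq> \<Union> (A' ` (e \<inter> f))" using \<rho>(3)[OF e] \<rho>(3)[OF f] by blast
    finally show "(L \<circ> \<rho>) e \<inter> (L \<circ> \<rho>) f \<subseteq> \<Union> (A' ` (e \<inter> f))" by simp
  qed
  then show ?thesis unfolding \<pi>_def by blast
qed

text \<open>The graph below is the join of two adjacent vertices with a 4-cycle; contracting a rim edge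
  of the cycle produces \<open>K\<^sub>5\<close>.\<close>

lemma no_blob_drawing_if_double_wheel:
  assumes dr: "blob_drawing V E A L" and dist: "distinct [x, w, n1, n2, r1, r2]"
    and E: "{x, w} \<in> E" "{x, n1} \<in> E" "{x, n2} \<in> E" "{x, r2} \<in> E" "{w, n1} \<in> E" "{w, n2} \<in> E"
      "{w, r2} \<in> E" "{n1, r1} \<in> E" "{n1, r2} \<in> E" "{n2, r1} \<in> E" "{n2, r2} \<in> E"
  shows False
proof -
  define E' where "E' = (`) (id(r1 := n1)) ` (E - {{n1, r1}})"
  obtain A' L' where dr': "blob_drawing (V - {r1}) E' A' L'"
    using blob_drawing_contract[OF dr E(8)] unfolding E'_def by blast
  have keep: "{y, z} \<in> E'" if "{y, z} \<in> E" "y \<noteq> r1" "z \<noteq> r1" for y z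
    unfolding E'_def
  proof
    show "{y, z} = (id(r1 := n1)) ` {y, z}" using that by auto
    show "{y, z} \<in> E - {{n1, r1}}" using that by (auto simp: doubleton_eq_iff)
  qed
  \<comment> \<open>This diagonal of the 4-cycle is the one adjacency of K5 that the contraction has
    to create; it comes from the edge \<open>{n2, r1}\<close>.\<close>
  have "{n1, n2} \<in> E'"
    unfolding E'_def
  proof
    show "{n1, n2} = (id(r1 := n1)) ` {n2, r1}" using dist by auto
    show "{n2, r1} \<in> E - {{n1, r1}}" using E dist by (auto simp: doubleton_eq_iff)
  qed
  moreover have "r2 \<noteq> r1" using dist by auto
  ultimately have all: "{x, w} \<in> E'" "{x, n1} \<in> E'" "{x, n2} \<in> E'" "{x, r2} \<in> E'" "{w, n1} \<in> E'"
     "{w, n2} \<in> E'" "{w, r2} \<in> E'" "{n1, n2} \<in> E'" "{n1, r2} \<in> E'" "{n2, r2} \<in> E'"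
    using keep E dist by simp_all
  show False
  proof (rule K5_no_blob_drawing[OF dr', of x w n1 n2 r2])
    fix y z assume "y \<in> {x, w, n1, n2, r2}" "z \<in> {x, w, n1, n2, r2}" "y \<noteq> z"
    then show "{y, z} \<in> E'" using all by (elim insertE emptyE) (simp_all add: insert_commute)
  qed (use dist in auto)
qed

text \<open>Mader's argument: in a minimal counterexample every edge has at least three common neighbours of
  its ends, since otherwise contracting it gives a smaller one. A vertex of degree at most five
  then has a neighbourhood so dense that a \<open>K\<^sub>5\<close> minor appears.\<close>

lemma blob_drawing_edge_bound:
  assumes "finite V" "V \<noteq> {}" "blob_drawing V E A L"
  shows "card E + 2 \<le> 3 * card V"
  using assms
proof (induction "card V" arbitrary: V E A L rule: less_induct)
  case less
  note finV = less.prems(1) and IH = less.hyps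
  show ?case
  proof (rule ccontr)
    assume "\<not> card E + 2 \<le> 3 * card V"
    then have "3 * card V - 1 \<le> card E" by simp
    \<comment> \<open>So many edges violate the bound, yet the degrees add up to only
      \<open>6 * card V - 2\<close>, which forces a vertex of degree at most 5. The summand 2 in the
      bound is the smallest for which this works.\<close>
    then obtain D where D: "D \<subseteq> E" "card D = 3 * card V - 1" "finite D"
      using obtain_subset_with_card_n by metis
    have dr: "blob_drawing V D A L"
    proof (rule blob_drawing_mono[OF less.prems(3) subset_refl D(1)])
      show "\<Union>D \<subseteq> V" using blob_edge[OF less.prems(3)] D(1) by blast
    qed
    have cV: "card V \<ge> 1" using finV less.prems(2) by (simp add: Suc_le_eq card_gt_0_iff)
    have edge: "e \<subseteq> V" "card e = 2" if "e \<in> D" for e using blob_edge[OF dr that] by auto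
    have vne: "y \<noteq> z" "y \<in> V" "z \<in> V" if "{y, z} \<in> D" for y z using edge[OF that] by auto
    define N where "N x = {y. {x, y} \<in> D}" for x
    have NV: "N x \<subseteq> V" for x using vne by (auto simp: N_def)
    then have finN: "finite (N x)" for x using finV finite_subset by blast
    have Nsym: "y \<in> N x \<longleftrightarrow> x \<in> N y" for x y by (simp add: N_def insert_commute)
    have cardN: "card (N x) = card {e \<in> D. x \<in> e}" for x
    proof (rule bij_betw_same_card)
      show "bij_betw (\<lambda>y. {x, y}) (N x) {e \<in> D. x \<in> e}"
      proof (rule bij_betw_imageI)
        show "inj_on (\<lambda>y. {x, y}) (N x)" by (auto simp: inj_on_def doubleton_eq_iff)
        show "(\<lambda>y. {x, y}) ` N x = {e \<in> D. x \<in> e}"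
        proof
          show "{e \<in> D. x \<in> e} \<subseteq> (\<lambda>y. {x, y}) ` N x"
          proof
            fix e assume e: "e \<in> {e \<in> D. x \<in> e}"
            then obtain y z where "e = {y, z}" using edge(2)[of e] by (auto simp: card_2_iff)
            then have "\<exists>w. e = {x, w}" using e by auto
            then show "e \<in> (\<lambda>y. {x, y}) ` N x" using e by (auto simp: N_def)
          qed
        qed (auto simp: N_def)
      qed
    qed

    \<comment> \<open>Contracting the edge loses it and one more edge for each common neighbour. At
      most \<open>3 * (card V - 1) - 2\<close> edges may remain, 4 fewer than in
      \<open>D\<close>.\<close>
    have common: "card (N u \<inter> N v) \<ge> 3" if uv: "{u, v} \<in> D" for u v
    proof -
      define \<pi> where "\<pi> = id(v := u)"
      \<comment> \<open>For each common neighbour \<open>w\<close> the copy \<open>{v, w}\<close> is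
        dropped in favour of \<open>{u, w}\<close>; on the remaining edges the contraction is
        injective.\<close>
      define C where "C = D - {{u, v}} - (\<lambda>w. {v, w}) ` (N u \<inter> N v)"
      obtain A' L' where "blob_drawing (V - {v}) ((`) \<pi> ` (D - {{u, v}})) A' L'"
        using blob_drawing_contract[OF dr uv] unfolding \<pi>_def by blast
      moreover have "card (V - {v}) < card V" using vne[OF uv] finV by (intro card_Diff1_less)
      moreover have "V - {v} \<noteq> {}" using vne[OF uv] by auto
      ultimately have b: "card ((`) \<pi> ` (D - {{u, v}})) + 2 \<le> 3 * card (V - {v})"
        using finV by (intro IH) auto
      have "inj_on ((`) \<pi>) C"
      proof (rule inj_onI)
        have v_edge: "\<exists>w. e = {v, w} \<and> \<pi> ` e = {u, w} \<and> {u, w} \<notin> D" if "e \<in> C" "v \<in> e" for e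
        proof -
          have "e \<in> {e \<in> D. v \<in> e}" using that by (auto simp: C_def)
          then obtain w where w: "e = {v, w}" "w \<noteq> v"
            using edge(2)[of e] by (auto simp: card_2_iff)
          moreover have "\<pi> ` e = {u, w}" using w by (auto simp: \<pi>_def)
          moreover have "{u, w} \<notin> D"
          proof
            assume "{u, w} \<in> D"
            then have "w \<in> N u \<inter> N v" using that(1) w(1) by (auto simp: N_def C_def)
            then show False using that(1) w(1) by (auto simp: C_def)
          qed
          ultimately show ?thesis by blast
        qed
        have other: "\<pi> ` e = e" if "v \<notin> e" for e using that by (auto simp: \<pi>_def image_iff)
        fix e f assume ef: "e \<in> C" "f \<in> C" "\<pi> ` e = \<pi> ` f"
        have CD: "C \<subseteq> D" by (auto simp: C_def)
        show "e = f"
        proof (cases "v \<in> e"; cases "v \<in> f")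
          assume "v \<in> e" "v \<in> f"
          then obtain w w' where "e = {v, w}" "f = {v, w'}" "{u, w} = {u, w'}"
            using v_edge[OF ef(1)] v_edge[OF ef(2)] ef(3) by metis
          then show ?thesis by (auto simp: doubleton_eq_iff)
        next
          assume "v \<in> e" "v \<notin> f"
          then show ?thesis using v_edge[OF ef(1)] other[of f] ef(2,3) CD by (metis subsetD)
        next
          assume "v \<notin> e" "v \<in> f"
          then show ?thesis using v_edge[OF ef(2)] other[of e] ef(1,3) CD by (metis subsetD)
        next
          assume "v \<notin> e" "v \<notin> f"
          then show ?thesis using other ef(3) by metis
        qed
      qed
      then have "card C = card ((`) \<pi> ` C)" by (simp add: card_image)
      also have "\<dots> \<le> card ((`) \<pi> ` (D - {{u, v}}))"
        using D(3) by (intro card_mono image_mono) (auto simp: C_def)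
      finally have "card C + 2 \<le> 3 * card (V - {v})" using b by simp
      moreover have "card D - 1 - card (N u \<inter> N v) \<le> card C"
      proof -
        have "card D - 1 = card (D - {{u, v}})" using uv D(3) by simp
        moreover have "card (D - {{u, v}}) - card ((\<lambda>w. {v, w}) ` (N u \<inter> N v)) \<le> card C"
          unfolding C_def using finN by (intro diff_card_le_card_Diff) auto
        moreover have "card ((\<lambda>w. {v, w}) ` (N u \<inter> N v)) \<le> card (N u \<inter> N v)"
          using finN by (intro card_image_le) auto
        ultimately show ?thesis by linarith
      qed
      moreover have "card (V - {v}) = card V - 1" using vne[OF uv] finV by simp
      ultimately show ?thesis using D(2) cV by linarith
    qed

    \<comment> \<open>By the same count, deleting \<open>x\<close> must remove at least 4 edges. The
      case of a single vertex is excluded beforehand, as \<open>D\<close> would have two edges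
      there.\<close>
    have min_degree: "card (N x) \<ge> 4" if x: "x \<in> V" for x
    proof -
      have "V - {x} \<noteq> {}"
      proof
        assume "V - {x} = {}"
        then have "V = {x}" using x by auto
        then have "D = {}" using edge by (metis card.empty card.insert card_mono equals0I finite.intros
              empty_iff numeral_2_eq_2 not_less_eq_eq le_refl One_nat_def)
        then show False using D(2) cV by simp
      qed
      moreover have "card (V - {x}) < card V" using x finV by (intro card_Diff1_less)
      moreover have "blob_drawing (V - {x}) {e \<in> D. x \<notin> e} A L"
        by (rule blob_drawing_mono[OF dr]) (use edge(1) in blast)+
      ultimately have "card {e \<in> D. x \<notin> e} + 2 \<le> 3 * card (V - {x})"
        using finV by (intro IH) auto
      moreover have "card D = card {e \<in> D. x \<notin> e} + card {e \<in> D. x \<in> e}"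
        using D(3) by (subst card_Un_disjoint[symmetric]) (auto intro!: arg_cong[of _ _ card])
      moreover have "card (V - {x}) = card V - 1" using x finV by simp
      ultimately show ?thesis using D(2) cV cardN[of x] by linarith
    qed

    have "(\<Sum>x\<in>V. card (N x)) = (\<Sum>x\<in>V. \<Sum>e | e \<in> D \<and> x \<in> e. 1 :: nat)"
      by (simp add: cardN)
    also have "\<dots> = (\<Sum>e\<in>D. \<Sum>x | x \<in> V \<and> x \<in> e. 1 :: nat)"
      using finV D(3) by (rule sum.swap_restrict)
    also have "\<dots> = (\<Sum>e\<in>D. 2)"
    proof (rule sum.cong[OF refl])
      fix e assume e: "e \<in> D"
      have "{x. x \<in> V \<and> x \<in> e} = e" using edge(1)[OF e] by auto
      then show "(\<Sum>x | x \<in> V \<and> x \<in> e. 1 :: nat) = 2" using edge(2)[OF e] by simp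
    qed
    finally have "(\<Sum>x\<in>V. card (N x)) < (\<Sum>x\<in>V. 6)" using D(2) cV by simp
    then obtain x where x: "x \<in> V" "card (N x) < 6"
      by (metis linorder_not_less sum_mono)
    have deg: "card (N x) = 4 \<or> card (N x) = 5" using min_degree[OF x(1)] x(2) by auto
    have xN: "x \<notin> N x" using vne(1)[of x x] by (auto simp: N_def)
    have nn: "card (N n \<inter> N x) \<ge> 3" "n \<notin> N n" if "n \<in> N x" for n
      using common[of n x] vne(1)[of n n] that by (auto simp: N_def insert_commute)

    \<comment> \<open>Among the at most 5 vertices of \<open>N x\<close> there are \<open>n\<close>
      itself and at least three neighbours of \<open>n\<close>, which leaves room for one
      non-neighbour only.\<close>
    have miss: "m \<in> N n \<or> m' \<in> N n"
      if "n \<in> N x" "m \<in> N x" "m' \<in> N x" "n \<noteq> m" "n \<noteq> m'" "m \<noteq> m'" for n m m'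
    proof (rule ccontr)
      assume "\<not> (m \<in> N n \<or> m' \<in> N n)"
      then have "{n, m, m'} \<inter> (N n \<inter> N x) = {}" using nn(2)[OF that(1)] by auto
      then have "card ({n, m, m'} \<union> (N n \<inter> N x)) = 3 + card (N n \<inter> N x)"
        using that finN by (subst card_Un_disjoint) auto
      moreover have "card ({n, m, m'} \<union> (N n \<inter> N x)) \<le> card (N x)"
        using that finN by (intro card_mono) auto
      ultimately show False using nn(1)[OF that(1)] deg by linarith
    qed
    have clique: False if all: "\<And>n m. n \<in> N x \<Longrightarrow> m \<in> N x \<Longrightarrow> n \<noteq> m \<Longrightarrow> m \<in> N n"
    proof -
      obtain Q where Q: "Q \<subseteq> N x" "card Q = 4"
        using deg obtain_subset_with_card_n[of 4 "N x"] by (metis le_refl numeral_le_iff semiring_norm(68,71,73,79) min_degree x(1))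
      obtain a b c d where abcd: "Q = {a, b, c, d}" "distinct [a, b, c, d]"
      proof -
        obtain a Q1 where 1: "Q = insert a Q1" "a \<notin> Q1" "card Q1 = 3" using card_eq_SucD[of Q 3] Q(2) by auto
        obtain b c d where "Q1 = {b, c, d}" "b \<noteq> c" "b \<noteq> d" "c \<noteq> d" using 1(3) by (auto simp: card_3_iff)
        then show thesis using 1 that[of a b c d] by auto
      qed
      show False
      proof (rule K5_no_blob_drawing[OF dr, of x a b c d])
        show "distinct [x, a, b, c, d]" using abcd Q(1) xN by auto
        fix y z assume yz: "y \<in> {x, a, b, c, d}" "z \<in> {x, a, b, c, d}" "y \<noteq> z"
        have "{x, a, b, c, d} = insert x Q" using abcd(1) by simp
        then have "y = x \<and> z \<in> N x \<or> z = x \<and> y \<in> N x \<or> y \<in> N x \<and> z \<in> N x"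
          using yz Q(1) by auto
        then show "{y, z} \<in> D"
          using all[of y z] yz(3) by (auto simp: N_def insert_commute)
      qed
    qed
    show False
    proof (cases "card (N x) = 4")
      case True
      have "N n \<inter> N x = N x - {n}" if n: "n \<in> N x" for n
        using nn[OF n] True n finN by (intro card_seteq) auto
      then show False using clique by blast
    next
      case False
      then have c5: "card (N x) = 5" using deg by simp
      \<comment> \<open>By \<open>miss\<close> both are adjacent to the remaining three neighbours
        of \<open>x\<close>. So \<open>n1\<close>, \<open>n2\<close> and two of these three form the
        4-cycle of a double wheel, whose hubs are \<open>x\<close> and the third one.\<close>
      obtain n1 n2 where n: "n1 \<in> N x" "n2 \<in> N x" "n1 \<noteq> n2" "n2 \<notin> N n1" using clique by blast
      have "card (N x - {n1, n2}) = 3" using c5 n finN by (subst card_Diff_subset) auto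
      then obtain r1 r2 r3 where r: "N x - {n1, n2} = {r1, r2, r3}" "r1 \<noteq> r2" "r1 \<noteq> r3" "r2 \<noteq> r3"
        by (auto simp: card_3_iff)
      define R where "R = N x - {n1, n2}"
      have nr: "s \<in> N n1" "s \<in> N n2" if "s \<in> R" for s
        using miss[of n1 n2 s] miss[of n2 n1 s] n that Nsym[of n1 n2] by (auto simp: R_def)
      have hub: False if w: "w \<in> R" "s \<in> R" "t \<in> R" "w \<noteq> s" "w \<noteq> t" "s \<noteq> t" "s \<in> N w" "t \<in> N w" for w s t
      proof (rule no_blob_drawing_if_double_wheel[OF dr, of x w n1 n2 s t])
        show "distinct [x, w, n1, n2, s, t]" using w n xN by (auto simp: R_def)
        show "{x, w} \<in> D" "{x, n1} \<in> D" "{x, n2} \<in> D" "{x, t} \<in> D"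
          using w n by (auto simp: R_def N_def)
        show "{w, n1} \<in> D" "{w, n2} \<in> D" using nr[OF w(1)] by (auto simp: N_def insert_commute)
        show "{w, t} \<in> D" using w(8) by (simp add: N_def)
        show "{n1, s} \<in> D" "{n1, t} \<in> D" "{n2, s} \<in> D" "{n2, t} \<in> D"
          using nr[OF w(2)] nr[OF w(3)] by (simp_all add: N_def)
      qed
      have R: "r1 \<in> R" "r2 \<in> R" "r3 \<in> R" using r(1) by (auto simp: R_def)
      then have RN: "r1 \<in> N x" "r2 \<in> N x" "r3 \<in> N x" by (auto simp: R_def)
      \<comment> \<open>Again by \<open>miss\<close>, at most one pair among \<open>r1\<close>,
        \<open>r2\<close>, \<open>r3\<close> is non-adjacent, and the vertex outside it can serve as
        a hub.\<close>
      show False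
      proof (cases "r1 \<in> N r3 \<and> r2 \<in> N r3")
        case True
        then show False using hub[of r3 r1 r2] R r by auto
      next
        case False
        then consider "r1 \<notin> N r3" | "r2 \<notin> N r3" by auto
        then show False
        proof cases
          case 1
          then have "r2 \<in> N r3" "r2 \<in> N r1"
            using miss[of r3 r1 r2] miss[of r1 r3 r2] RN r Nsym[of r1 r3] by auto
          then show False using hub[of r2 r1 r3] R r Nsym by auto
        next
          case 2
          then have "r1 \<in> N r3" "r1 \<in> N r2"
            using miss[of r3 r2 r1] miss[of r2 r3 r1] RN r Nsym[of r2 r3] by auto
          then show False using hub[of r1 r2 r3] R r Nsym by auto
        qed
      qed
    qed
  qed
qed

section \<open>Sparsity of the subgraphs of a planar graph\<close>

lemma plane_drawing_imp_blob_drawing: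
  assumes dr: "plane_drawing V E p \<gamma>" and E: "\<And>e. e \<in> E \<Longrightarrow> e \<subseteq> V \<and> card e = 2"
  shows "blob_drawing V E (\<lambda>v. {p v}) (\<lambda>e. path_image (\<gamma> e))"
proof -
  have inj: "inj_on p V"
    and arc: "\<And>e. e \<in> E \<Longrightarrow> arc (\<gamma> e)"
    and ends: "\<And>e. e \<in> E \<Longrightarrow> path_image (\<gamma> e) \<inter> p ` V = p ` e"
    and cross: "\<And>e f. e \<in> E \<Longrightarrow> f \<in> E \<Longrightarrow> e \<noteq> f \<Longrightarrow> path_image (\<gamma> e) \<inter> path_image (\<gamma> f) \<subseteq> p ` (e \<inter> f)"
    using dr unfolding plane_drawing_def by simp_all
  have UN: "(\<Union>v\<in>e. {p v}) = p ` e" for e by auto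
  show ?thesis
    unfolding blob_drawing_def UN
  proof (intro conjI ballI impI)
    fix u v assume "u \<in> V" "v \<in> V" "u \<noteq> v"
    then show "{p u} \<inter> {p v} = {}" using inj by (auto simp: inj_on_def)
  next
    fix e assume e: "e \<in> E"
    show "e \<subseteq> V" "card e = 2" using E[OF e] by auto
    have "path (\<gamma> e)" using arc[OF e] by (rule arc_imp_path)
    then show "compact (path_image (\<gamma> e))" by (rule compact_path_image)
    have "path_image (\<gamma> e) \<union> p ` e = path_image (\<gamma> e)" using ends[OF e] by blast
    then show "path_connected (path_image (\<gamma> e) \<union> p ` e)"
      using \<open>path (\<gamma> e)\<close> by (simp add: path_connected_path_image)
  next
    fix e v assume e: "e \<in> E" and v: "v \<in> V - e"
    then have "p v \<notin> p ` e" using inj E[OF e] by (auto simp: inj_on_def)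
    then show "path_image (\<gamma> e) \<inter> {p v} = {}" using ends[OF e] v by blast
  next
    fix e f assume "e \<in> E" "f \<in> E" "e \<noteq> f"
    then show "path_image (\<gamma> e) \<inter> path_image (\<gamma> f) \<subseteq> p ` (e \<inter> f)" by (rule cross)
  qed simp_all
qed

text \<open>This is Hall's condition, with capacity 3 at every vertex, for charging each edge to one
  of its ends; hence the form with an arbitrary \<open>F\<close> and the vertices it covers.\<close>

lemma planar_card_edges_le:
  assumes sg: "signed_graph V E \<sigma>" and pl: "planar V E" and F: "F \<subseteq> E"
  shows "card F \<le> 3 * card (\<Union>F)"
proof (cases "F = {}")
  case False
  have E: "e \<subseteq> V \<and> card e = 2" if "e \<in> E" for e using sg that by (simp add: signed_graph_def)
  obtain p \<gamma> where "plane_drawing V E p \<gamma>" using pl unfolding planar_def by blast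
  then have dr: "blob_drawing V E (\<lambda>v. {p v}) (\<lambda>e. path_image (\<gamma> e))"
    by (rule plane_drawing_imp_blob_drawing) (rule E)
  have FV: "\<Union>F \<subseteq> V" using E F by blast
  have "finite (\<Union>F)" using FV sg by (auto simp: signed_graph_def intro: finite_subset)
  moreover have "\<Union>F \<noteq> {}"
  proof -
    obtain e where e: "e \<in> F" using False by blast
    then have "e \<noteq> {}" using E[of e] F by auto
    then show ?thesis using e by blast
  qed
  moreover have "blob_drawing (\<Union>F) F (\<lambda>v. {p v}) (\<lambda>e. path_image (\<gamma> e))"
    by (rule blob_drawing_mono[OF dr FV F subset_refl])
  ultimately show ?thesis using blob_drawing_edge_bound[of "\<Union>F" F] by fastforce
qed simp

section \<open>Orientations and the graph polynomial\<close>

text \<open>Hall's theorem with capacities, by the classical induction. A tight proper subfamily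
  exhausts the capacity of its vertices, and the two parts are solved separately. If there is none,
  every nonempty proper subfamily has a unit to spare, so any edge may be charged to any of its
  vertices of positive capacity. In an oriented graph, \<open>h e\<close> is the tail of
  \<open>e\<close>.\<close>

lemma capacitated_orientation:
  fixes c :: "'a \<Rightarrow> nat"
  assumes "finite E" "\<And>e. e \<in> E \<Longrightarrow> finite e" "\<And>F. F \<subseteq> E \<Longrightarrow> card F \<le> sum c (\<Union>F)"
  shows "\<exists>h. (\<forall>e\<in>E. h e \<in> e) \<and> (\<forall>v. card {e \<in> E. h e = v} \<le> c v)"
  using assms
proof (induction "card E" arbitrary: E c rule: less_induct)
  case less
  note finE = less.prems(1) and fine = less.prems(2) and hall = less.prems(3)
  show ?case
  proof (cases "E = {}")
    case True
    then show ?thesis by auto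
  next
    case False
    show ?thesis
    proof (cases "\<exists>F. F \<subset> E \<and> F \<noteq> {} \<and> card F = sum c (\<Union>F)")
      case True
      then obtain F where F: "F \<subset> E" "F \<noteq> {}" "card F = sum c (\<Union>F)" by blast
      have finF: "finite F" using F(1) finE finite_subset by blast
      have finU: "finite (\<Union>G)" if "G \<subseteq> E" for G
        using that finE fine finite_subset by (metis finite_Union subsetD)
      have "\<exists>h. (\<forall>e\<in>F. h e \<in> e) \<and> (\<forall>v. card {e \<in> F. h e = v} \<le> c v)"
        using F(1) finE fine hall by (intro less.hyps psubset_card_mono finF) auto
      then obtain h1 where h1: "\<And>e. e \<in> F \<Longrightarrow> h1 e \<in> e" "\<And>v. card {e \<in> F. h1 e = v} \<le> c v" by blast
      \<comment> \<open>The vertices of the tight \<open>F\<close> are closed for the rest. Hall's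
        condition survives: apply it to \<open>G \<union> F\<close> and subtract the equality for
        \<open>F\<close>.\<close>
      define c' where "c' = (\<lambda>v. if v \<in> \<Union>F then 0 else c v)"
      have hall': "card G \<le> sum c' (\<Union>G)" if G: "G \<subseteq> E - F" for G
      proof -
        have GE: "G \<subseteq> E" "finite G" using G finE finite_subset by blast+
        have "card G + card F = card (G \<union> F)"
          using G finF GE by (subst card_Un_disjoint) auto
        also have "\<dots> \<le> sum c (\<Union>(G \<union> F))" using GE F(1) by (intro hall) auto
        also have "\<Union>(G \<union> F) = (\<Union>G - \<Union>F) \<union> \<Union>F" by auto
        also have "sum c \<dots> = sum c (\<Union>G - \<Union>F) + sum c (\<Union>F)"
          using finU[of G] finU[of F] GE F(1) by (intro sum.union_disjoint) auto
        also have "sum c (\<Union>G - \<Union>F) = sum c' (\<Union>G - \<Union>F)"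
          by (rule sum.cong) (auto simp: c'_def)
        also have "\<dots> = sum c' (\<Union>G)"
          using finU[OF GE(1)] by (intro sum.mono_neutral_left) (auto simp: c'_def)
        finally show ?thesis using F(3) by simp
      qed
      have "card (E - F) < card E"
        using F finE by (intro psubset_card_mono) auto
      then have "\<exists>h. (\<forall>e\<in>E - F. h e \<in> e) \<and> (\<forall>v. card {e \<in> E - F. h e = v} \<le> c' v)"
        using finE fine hall' by (intro less.hyps) auto
      then obtain h2 where h2: "\<And>e. e \<in> E - F \<Longrightarrow> h2 e \<in> e" "\<And>v. card {e \<in> E - F. h2 e = v} \<le> c' v" by blast
      define h where "h = (\<lambda>e. if e \<in> F then h1 e else h2 e)"
      have "card {e \<in> E. h e = v} \<le> c v" for v
      proof -
        have "{e \<in> E. h e = v} = {e \<in> F. h1 e = v} \<union> {e \<in> E - F. h2 e = v}"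
          using F(1) by (auto simp: h_def)
        then have le: "card {e \<in> E. h e = v} \<le> card {e \<in> F. h1 e = v} + card {e \<in> E - F. h2 e = v}"
          by (simp add: card_Un_le)
        show ?thesis
        proof (cases "v \<in> \<Union>F")
          case True
          then show ?thesis using le h1(2)[of v] h2(2)[of v] by (simp add: c'_def)
        next
          case False
          then have "{e \<in> F. h1 e = v} = {}" "c' v = c v" using h1(1) by (auto simp: c'_def)
          then have "card {e \<in> F. h1 e = v} = 0" "c' v = c v" by (simp_all only: card.empty)
          then show ?thesis using le h2(2)[of v] by linarith
        qed
      qed
      moreover have "h e \<in> e" if "e \<in> E" for e
        using h1(1)[of e] h2(1)[of e] that by (cases "e \<in> F") (simp_all add: h_def)
      ultimately show ?thesis by blast
    next
      case no_tight: False
      obtain e where e: "e \<in> E" using False by auto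
      have "card {e} \<le> sum c (\<Union>{e})" using e by (intro hall) auto
      then have "sum c e \<noteq> 0" by simp
      then obtain v where v: "v \<in> e" "c v \<noteq> 0" by (meson sum.neutral)
      define c' where "c' = c(v := c v - 1)"
      have hall': "card G \<le> sum c' (\<Union>G)" if G: "G \<subseteq> E - {e}" for G
      proof (cases "G = {}")
        case False
        have "G \<subset> E" using G e by auto
        then have "card G \<noteq> sum c (\<Union>G)" "card G \<le> sum c (\<Union>G)" using no_tight False hall by auto
        moreover have "sum c (\<Union>G) \<le> sum c' (\<Union>G) + 1"
        proof -
          have fU: "finite (\<Union>G)" using G finE fine finite_subset by (metis Diff_subset finite_Union subset_trans subsetD)
          have "sum c (\<Union>G) \<le> sum (\<lambda>w. c' w + (if w = v then 1 else 0)) (\<Union>G)"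
            by (rule sum_mono) (auto simp: c'_def)
          also have "\<dots> = sum c' (\<Union>G) + (if v \<in> \<Union>G then 1 else 0)"
            using fU by (simp add: sum.distrib)
          finally show ?thesis by (auto split: if_splits)
        qed
        ultimately show ?thesis by linarith
      qed simp
      have "card (E - {e}) < card E" using e finE by (intro psubset_card_mono) auto
      then have "\<exists>h. (\<forall>f\<in>E - {e}. h f \<in> f) \<and> (\<forall>w. card {f \<in> E - {e}. h f = w} \<le> c' w)"
        using finE fine hall' by (intro less.hyps) auto
      then obtain h where h: "\<And>f. f \<in> E - {e} \<Longrightarrow> h f \<in> f" "\<And>w. card {f \<in> E - {e}. h f = w} \<le> c' w" by blast
      have "card {f \<in> E. (h(e := v)) f = w} \<le> c w" for w
      proof (cases "w = v")
        case True
        have "{f \<in> E. (h(e := v)) f = w} = insert e {f \<in> E - {e}. h f = w}" using e True by auto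
        then have "card {f \<in> E. (h(e := v)) f = w} \<le> Suc (card {f \<in> E - {e}. h f = w})"
          by (simp add: card_insert_le_m1 card_insert_if finE)
        then show ?thesis using h(2)[of w] True v(2) by (simp add: c'_def)
      next
        case False
        then have "{f \<in> E. (h(e := v)) f = w} = {f \<in> E - {e}. h f = w}" by auto
        then show ?thesis using h(2)[of w] False by (simp add: c'_def)
      qed
      moreover have "\<forall>f\<in>E. (h(e := v)) f \<in> f" using h(1) v(1) by simp
      ultimately show ?thesis by blast
    qed
  qed
qed

lemma prod_single:
  fixes k :: "'i \<Rightarrow> 'a::comm_monoid_add" and a :: "'i \<Rightarrow> 'b::comm_semiring_1"
  shows "(\<Prod>x\<in>X. Poly_Mapping.single (k x) (a x)) = Poly_Mapping.single (sum k X) (prod a X)"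
  by (induction X rule: infinite_finite_induct) (simp_all add: mult_single)

text \<open>If \<open>\<phi>\<close> is a proper colouring with colours \<open>\<plusminus>1\<close>, then \<open>- \<sigma>(uv) = \<phi>(u) \<phi>(v)\<close>, so substituting
  \<open>\<phi>(v) x\<^sub>v\<close> for \<open>x\<^sub>v\<close> turns every factor into \<open>\<plusminus>(x\<^sub>u + x\<^sub>v)\<close>: no cancellation takes place
  and the monomial of every orientation survives.\<close>

lemma graph_poly_orientation_coeff:
  fixes V :: "'a::linorder set"
  assumes sg: "signed_graph V E \<sigma>" and col: "colorable V E \<sigma> 2"
    and h: "\<And>e. e \<in> E \<Longrightarrow> h e \<in> e"
  shows "\<exists>t. Poly_Mapping.lookup (graph_poly E \<sigma>) t \<noteq> 0 \<and>
             (\<forall>v. Poly_Mapping.lookup t v \<le> card {e \<in> E. h e = v})"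
proof -
  define S where "S = {(u, v). u < v \<and> {u, v} \<in> E}"
  let ?single = "\<lambda>v::'a. Poly_Mapping.single v (1::nat)"
  obtain \<phi> where \<phi>: "proper_coloring V E \<sigma> (sym_colors 2) \<phi>"
    using col by (auto simp: colorable_def)
  have finV: "finite V" and EV: "\<And>e. e \<in> E \<Longrightarrow> e \<subseteq> V" and sgn: "\<And>e. e \<in> E \<Longrightarrow> \<sigma> e \<in> {1, -1}"
    using sg by (auto simp: signed_graph_def)
  have "E \<subseteq> Pow V" using EV by blast
  then have finE: "finite E" using finV by (meson finite_Pow_iff finite_subset)
  have SV: "S \<subseteq> V \<times> V" using EV by (auto simp: S_def)
  then have finS: "finite S" using finV by (meson finite_SigmaI finite_subset)
  have "sym_colors 2 = {-1..1} - {0}" by (simp add: sym_colors_def)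
  then have \<phi>1: "\<phi> v = 1 \<or> \<phi> v = -1" if "v \<in> V" for v
    using \<phi> that by (force simp: proper_coloring_def)
  have \<phi>\<sigma>: "- \<sigma> {u, v} = \<phi> u * \<phi> v" if "(u, v) \<in> S" for u v
  proof -
    have uv: "u \<in> V" "v \<in> V" "{u, v} \<in> E" using that EV by (auto simp: S_def)
    then have "\<phi> u \<noteq> \<sigma> {u, v} * \<phi> v" using \<phi> by (simp add: proper_coloring_def)
    then show ?thesis using \<phi>1[OF uv(1)] \<phi>1[OF uv(2)] sgn[OF uv(3)] by auto
  qed
  \<comment> \<open>\<open>X\<close> is the set of factors that contribute the variable of their
    smaller end, so \<open>T X\<close> is the exponent of one term of the expanded product.
    \<open>ev\<close> evaluates a monomial at \<open>\<phi>\<close>.\<close>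
  define T where "T X = (\<Sum>p\<in>X. ?single (fst p)) + (\<Sum>p\<in>S - X. ?single (snd p))" for X
  define ev where "ev t = (\<Prod>v\<in>V. \<phi> v ^ Poly_Mapping.lookup t v)" for t
  have ev_add: "ev (s + t) = ev s * ev t" for s t
    by (simp add: ev_def lookup_add power_add prod.distrib)
  have ev_0: "ev 0 = 1" by (simp add: ev_def)
  have ev_single: "ev (?single v) = \<phi> v" if "v \<in> V" for v
  proof -
    have "ev (?single v) = (\<Prod>w\<in>V. if w = v then \<phi> w else 1)"
      unfolding ev_def by (rule prod.cong) (auto simp: lookup_single)
    then show ?thesis using finV that by simp
  qed
  have ev_sum: "ev (\<Sum>p\<in>X. ?single (f p)) = (\<Prod>p\<in>X. \<phi> (f p))" if "f ` X \<subseteq> V" for X and f :: "'a \<times> 'a \<Rightarrow> 'a"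
    using that by (induction X rule: infinite_finite_induct) (simp_all add: ev_0 ev_add ev_single del: One_nat_def)
  define s where "s = (\<Prod>p\<in>S. \<phi> (fst p))"
  \<comment> \<open>As \<open>\<phi>\<close> squares to 1, the product of
    \<open>\<phi> (fst p)\<close> over \<open>S - X\<close> is \<open>s\<close> times that over
    \<open>X\<close>. So the coefficient of a term depends only on its monomial, and terms with
    equal monomials have equal signs.\<close>
  have coeff: "(\<Prod>p\<in>S - X. \<phi> (fst p) * \<phi> (snd p)) = s * ev (T X)" if X: "X \<subseteq> S" for X
  proof -
    have "X \<subseteq> V \<times> V" "S - X \<subseteq> V \<times> V" using X SV by auto
    then have V: "fst ` X \<subseteq> V" "snd ` (S - X) \<subseteq> V" by auto
    have "s = (\<Prod>p\<in>X. \<phi> (fst p)) * (\<Prod>p\<in>S - X. \<phi> (fst p))"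
      unfolding s_def using prod.subset_diff[OF X finS] by (simp add: mult.commute)
    moreover have "(\<Prod>p\<in>X. \<phi> (fst p)) * (\<Prod>p\<in>X. \<phi> (fst p)) = 1"
      unfolding prod.distrib[symmetric] using V(1) \<phi>1 by (intro prod.neutral) fastforce
    ultimately show ?thesis
      unfolding T_def ev_add ev_sum[OF V(1)] ev_sum[OF V(2)]
      by (simp add: prod.distrib algebra_simps)
  qed
  have "graph_poly E \<sigma> = (\<Prod>p\<in>S. Poly_Mapping.single (?single (fst p)) 1
      + Poly_Mapping.single (?single (snd p)) (\<phi> (fst p) * \<phi> (snd p)))"
    unfolding graph_poly_def S_def
  proof (rule prod.cong[OF refl], clarify)
    fix u v assume uv: "u < v" "{u, v} \<in> E"
    have "of_int (\<sigma> {u, v}) * var v = Poly_Mapping.single (?single v) (\<sigma> {u, v})"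
      unfolding var_def single_of_int [symmetric] mult_single by simp
    moreover have "\<phi> u * \<phi> v = - \<sigma> {u, v}" using \<phi>\<sigma>[of u v] uv by (simp add: S_def)
    ultimately show "var u - of_int (\<sigma> {u, v}) * var v = Poly_Mapping.single (?single (fst (u, v))) 1
      + Poly_Mapping.single (?single (snd (u, v))) (\<phi> (fst (u, v)) * \<phi> (snd (u, v)))"
      by (simp add: var_def single_uminus)
  qed
  also have "\<dots> = (\<Sum>X\<in>Pow S. Poly_Mapping.single (T X) (\<Prod>p\<in>S - X. \<phi> (fst p) * \<phi> (snd p)))"
    unfolding prod_add[OF finS] by (simp add: prod_single mult_single T_def)
  also have "\<dots> = (\<Sum>X\<in>Pow S. Poly_Mapping.single (T X) (s * ev (T X)))"
    by (rule sum.cong) (simp_all add: coeff)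
  finally have P: "graph_poly E \<sigma> = (\<Sum>X\<in>Pow S. Poly_Mapping.single (T X) (s * ev (T X)))" .
  have P': "Poly_Mapping.lookup (graph_poly E \<sigma>) t = s * ev t * int (card {X \<in> Pow S. T X = t})" for t
  proof -
    have "Poly_Mapping.lookup (graph_poly E \<sigma>) t = (\<Sum>X\<in>Pow S. if T X = t then s * ev t else 0)"
      unfolding P lookup_sum by (rule sum.cong) (auto simp: lookup_single)
    also have "\<dots> = s * ev t * int (card {X \<in> Pow S. T X = t})"
      using finS by (simp add: sum.If_cases Int_def)
    finally show ?thesis .
  qed
  have s_ev: "s \<noteq> 0" "\<And>t. ev t \<noteq> 0"
  proof -
    show "s \<noteq> 0" unfolding s_def using finS \<phi>1 SV by (force simp: prod_zero_iff)
    show "ev t \<noteq> 0" for t unfolding ev_def using finV \<phi>1 by (force simp: prod_zero_iff)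
  qed
  \<comment> \<open>In the term of \<open>X\<close> every factor contributes the end chosen by
    \<open>h\<close>, so the exponents are outdegrees. The set of terms with this monomial contains
    \<open>X\<close> itself and is therefore nonempty.\<close>
  define X where "X = {p \<in> S. h {fst p, snd p} = fst p}"
  then have "X \<in> {Y \<in> Pow S. T Y = T X}" by auto
  moreover have "finite {Y \<in> Pow S. T Y = T X}" using finS by simp
  ultimately have "card {Y \<in> Pow S. T Y = T X} \<noteq> 0" by (metis card_eq_0_iff empty_iff)
  then have "Poly_Mapping.lookup (graph_poly E \<sigma>) (T X) \<noteq> 0" unfolding P' using s_ev by simp
  moreover have "Poly_Mapping.lookup (T X) w \<le> card {e \<in> E. h e = w}" for w
  proof -
    have hS: "h {fst p, snd p} = snd p" if "p \<in> S - X" for p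
      using h[of "{fst p, snd p}"] that by (auto simp: X_def S_def)
    have "(\<Sum>p\<in>X. ?single (fst p)) = (\<Sum>p\<in>X. ?single (h {fst p, snd p}))"
      by (rule sum.cong) (simp_all add: X_def)
    moreover have "(\<Sum>p\<in>S - X. ?single (snd p)) = (\<Sum>p\<in>S - X. ?single (h {fst p, snd p}))"
      by (rule sum.cong) (simp_all add: hS del: Diff_iff)
    ultimately have "T X = (\<Sum>p\<in>X. ?single (h {fst p, snd p})) + (\<Sum>p\<in>S - X. ?single (h {fst p, snd p}))"
      unfolding T_def by simp
    also have "\<dots> = (\<Sum>p\<in>S. ?single (h {fst p, snd p}))"
      using sum.subset_diff[of X S "\<lambda>p. ?single (h {fst p, snd p})"] finS by (simp add: X_def add.commute)
    finally have "Poly_Mapping.lookup (T X) w = (\<Sum>p\<in>S. if h {fst p, snd p} = w then 1 else 0)"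
      by (simp add: lookup_sum lookup_single when_def del: One_nat_def)
    also have "\<dots> = card {p \<in> S. h {fst p, snd p} = w}"
      using finS by (simp add: sum.If_cases Int_def)
    also have "\<dots> \<le> card {e \<in> E. h e = w}"
    proof (rule card_inj_on_le)
      show "inj_on (\<lambda>p. {fst p, snd p}) {p \<in> S. h {fst p, snd p} = w}"
        by (auto simp: inj_on_def doubleton_eq_iff S_def)
    qed (use finE in \<open>auto simp: S_def\<close>)
    finally show ?thesis .
  qed
  ultimately show ?thesis by blast
qed

lemma planar_AT_number_le_4:
  fixes V :: "'a::linorder set"
  assumes sg: "signed_graph V E \<sigma>" and pl: "planar V E" and col: "colorable V E \<sigma> 2"
  shows "AT_number V E \<sigma> \<le> 4"
proof -
  have EV: "E \<subseteq> Pow V" and finV: "finite V" using sg by (auto simp: signed_graph_def)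
  then have "finite E" by (meson finite_Pow_iff finite_subset)
  moreover have "finite e" if "e \<in> E" for e using that EV finV by (auto intro: finite_subset)
  moreover have "card F \<le> sum (\<lambda>_. 3) (\<Union>F)" if "F \<subseteq> E" for F
    using planar_card_edges_le[OF sg pl that] by simp
  ultimately have "\<exists>h. (\<forall>e\<in>E. h e \<in> e) \<and> (\<forall>v. card {e \<in> E. h e = v} \<le> 3)"
    by (rule capacitated_orientation)
  then obtain h where h: "\<And>e. e \<in> E \<Longrightarrow> h e \<in> e" "\<And>v. card {e \<in> E. h e = v} \<le> 3" by blast
  from graph_poly_orientation_coeff[OF sg col h(1)]
  obtain t where "Poly_Mapping.lookup (graph_poly E \<sigma>) t \<noteq> 0"
    and t: "\<And>v. Poly_Mapping.lookup t v \<le> card {e \<in> E. h e = v}" by blast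
  moreover have "Poly_Mapping.lookup t v < 4" for v using order_trans[OF t h(2), of v] by simp
  ultimately have "AT_bound V E \<sigma> 4" unfolding AT_bound_def by blast
  then show ?thesis unfolding AT_number_def by (rule Least_le)
qed

section \<open>A planar signed graph that is not 3-choosable\<close>

text \<open>With this numbering \<open>n div 2\<close> recovers the matching edge and the parity of
  \<open>n\<close> tells its end. The common neighbours carry the largest numbers.\<close>

definition book_graph :: "nat set set" where
  "book_graph = (\<lambda>n. {n, 18}) ` {..<18} \<union> (\<lambda>n. {n, 19}) ` {..<18} \<union> (\<lambda>i. {2 * i, 2 * i + 1}) ` {..<9}"

text \<open>The matching lies on the real axis between the two common neighbours, so that every edge
  can be a straight segment.\<close>

definition book_point :: "nat \<Rightarrow> complex" where
  "book_point n = (if n = 18 then \<i> else if n = 19 then - \<i> else of_nat n)"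

lemma book_point_simps: "n < 18 \<Longrightarrow> book_point n = of_nat n" "book_point 18 = \<i>" "book_point 19 = - \<i>"
  by (simp_all add: book_point_def)

lemma inj_book_point: "inj_on book_point {..<20}"
proof (rule inj_onI)
  fix x y assume xy: "x \<in> {..<20}" "y \<in> {..<20}" "book_point x = book_point y"
  have *: "n < 18 \<or> n = 18 \<or> n = 19" if "n \<in> {..<20}" for n :: nat using that by auto
  show "x = y"
    using *[OF xy(1)] *[OF xy(2)] xy(3) by (elim disjE) (auto simp: book_point_def complex_eq_iff)
qed

text \<open>Descriptions by real and imaginary parts turn incidences into arithmetic. Segments to 18
  lie on or above the axis, those to 19 on or below it, and the matching occupies disjoint intervals
  of it; so segments of different kinds meet only in a vertex on the axis.\<close>

lemma planar_book_graph: "planar {..<20} book_graph"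
  unfolding planar_def
proof (intro exI)
  let ?\<gamma> = "\<lambda>e. linepath (book_point (Min e)) (book_point (Max e))"
  have seg: "path_image (?\<gamma> {a, b}) = closed_segment (book_point a) (book_point b)" if "a < b" for a b
    using that by (simp add: max_def min_def)
  define Up where "Up n = closed_segment (of_nat n) \<i>" for n
  define Lo where "Lo n = closed_segment (of_nat n) (- \<i>)" for n
  define Mi where "Mi i = closed_segment (of_nat (2 * i)) (of_nat (2 * i + 1) :: complex)" for i
  have Up: "z \<in> Up n \<longleftrightarrow> Im z \<in> {0..1} \<and> Re z = (1 - Im z) * real n" for z n
  proof
    assume "z \<in> Up n"
    then show "Im z \<in> {0..1} \<and> Re z = (1 - Im z) * real n"
      by (auto simp: Up_def in_segment)
  next
    assume *: "Im z \<in> {0..1} \<and> Re z = (1 - Im z) * real n"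
    then have "z = (1 - Im z) *\<^sub>R of_nat n + Im z *\<^sub>R \<i>" by (simp add: complex_eq_iff)
    moreover have "0 \<le> Im z" "Im z \<le> 1" using * by auto
    ultimately show "z \<in> Up n" unfolding Up_def in_segment(1) by (intro exI[of _ "Im z"] conjI)
  qed
  have Lo: "z \<in> Lo n \<longleftrightarrow> - Im z \<in> {0..1} \<and> Re z = (1 + Im z) * real n" for z n
  proof
    assume "z \<in> Lo n"
    then show "- Im z \<in> {0..1} \<and> Re z = (1 + Im z) * real n"
      by (auto simp: Lo_def in_segment)
  next
    assume *: "- Im z \<in> {0..1} \<and> Re z = (1 + Im z) * real n"
    then have "z = (1 - (- Im z)) *\<^sub>R of_nat n + (- Im z) *\<^sub>R (- \<i>)" by (simp add: complex_eq_iff)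
    moreover have "0 \<le> - Im z" "- Im z \<le> 1" using * by auto
    ultimately show "z \<in> Lo n" unfolding Lo_def in_segment(1) by (intro exI[of _ "- Im z"] conjI)
  qed
  have Mi: "z \<in> Mi i \<longleftrightarrow> Im z = 0 \<and> Re z \<in> {2 * real i..2 * real i + 1}" for z i
  proof
    assume "z \<in> Mi i"
    then obtain u where u: "0 \<le> u" "u \<le> 1" "z = (1 - u) *\<^sub>R of_nat (2 * i) + u *\<^sub>R of_nat (2 * i + 1)"
      unfolding Mi_def in_segment(1) by (elim exE conjE) (rule that)
    have "Re z = (1 - u) * (2 * real i) + u * (2 * real i + 1)" "Im z = 0" unfolding u(3) by simp_all
    moreover have "(1 - u) * (2 * real i) + u * (2 * real i + 1) = 2 * real i + u" by (simp add: algebra_simps)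
    ultimately show "Im z = 0 \<and> Re z \<in> {2 * real i..2 * real i + 1}" using u(1,2) by simp
  next
    assume *: "Im z = 0 \<and> Re z \<in> {2 * real i..2 * real i + 1}"
    define u where "u = Re z - 2 * real i"
    have "Re z = 2 * real i + u" by (simp add: u_def)
    also have "\<dots> = (1 - u) * (2 * real i) + u * (2 * real i + 1)" by (simp add: algebra_simps)
    finally have "z = (1 - u) *\<^sub>R of_nat (2 * i) + u *\<^sub>R of_nat (2 * i + 1)"
      using * by (simp add: complex_eq_iff)
    moreover have "0 \<le> u" "u \<le> 1" using * by (auto simp: u_def)
    ultimately show "z \<in> Mi i" unfolding Mi_def in_segment(1) by (intro exI[of _ u] conjI)
  qed
  have cases: "(\<exists>n<18. e = {n, 18} \<and> path_image (?\<gamma> e) = Up n) \<or> (\<exists>n<18. e = {n, 19} \<and> path_image (?\<gamma> e) = Lo n) \<or>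
      (\<exists>i<9. e = {2 * i, 2 * i + 1} \<and> path_image (?\<gamma> e) = Mi i)" if "e \<in> book_graph" for e
  proof -
    have "path_image (?\<gamma> {n, 18}) = Up n" "path_image (?\<gamma> {n, 19}) = Lo n" if "n < 18" for n
      using that seg[of n 18] seg[of n 19] unfolding Up_def Lo_def by (simp_all add: book_point_simps)
    moreover have "path_image (?\<gamma> {2 * i, 2 * i + 1}) = Mi i" if "i < 9" for i
      using that seg[of "2 * i" "2 * i + 1"] unfolding Mi_def by (simp add: book_point_simps)
    ultimately show ?thesis using that unfolding book_graph_def by blast
  qed
  have pair: "\<exists>a b. e = {a, b} \<and> a < b \<and> a < 20 \<and> b < 20" if "e \<in> book_graph" for e
    using that unfolding book_graph_def by fastforce
  have pt: "book_point v \<in> Up n \<longleftrightarrow> v = n \<or> v = 18" "book_point v \<in> Lo n \<longleftrightarrow> v = n \<or> v = 19"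
    if "v < 20" "n < 18" for v n
    using that by (auto simp: Up Lo book_point_def)
  have pt3: "book_point v \<in> Mi i \<longleftrightarrow> v = 2 * i \<or> v = 2 * i + 1" if "v < 20" "i < 9" for v i
    using that by (auto simp: Mi book_point_def)
  show "plane_drawing {..<20} book_graph book_point ?\<gamma>"
    unfolding plane_drawing_def
  proof (intro conjI ballI impI inj_book_point)
    fix e assume e: "e \<in> book_graph"
    obtain a b where ab: "e = {a, b}" "a < b" "a < 20" "b < 20" using pair[OF e] by blast
    have "book_point a \<noteq> book_point b" using inj_onD[OF inj_book_point, of a b] ab by auto
    then show "arc (?\<gamma> e)" using ab by (simp add: max_def min_def)
    show "{pathstart (?\<gamma> e), pathfinish (?\<gamma> e)} = book_point ` e" using ab by (simp add: max_def min_def)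
    show "path_image (?\<gamma> e) \<inter> book_point ` {..<20} = book_point ` e"
      using cases[OF e] by (elim disjE exE conjE) (auto simp: pt pt3)
  next
    fix e f assume e: "e \<in> book_graph" and f: "f \<in> book_graph" and ef: "e \<noteq> f"
    let ?Q = "\<lambda>e f. path_image (?\<gamma> e) \<inter> path_image (?\<gamma> f) \<subseteq> book_point ` (e \<inter> f)"
    have apex: "z \<in> book_point ` ({n, v} \<inter> {m, v})" if "z = book_point v" for z n m v
      using that by (intro image_eqI[of _ _ v]) auto
    have foot: "z \<in> book_point ` ({n, v} \<inter> {k, l})" if "z = of_nat n" "n < 18" "n = k \<or> n = l" for z n v k l
      using that by (intro image_eqI[of _ _ n]) (auto simp: book_point_simps)
    have UU: "Up n \<inter> Up m \<subseteq> book_point ` ({n, 18} \<inter> {m, 18})" if "n \<noteq> m" for n m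
    proof
      fix z assume "z \<in> Up n \<inter> Up m"
      then have *: "Re z = (1 - Im z) * real n" "Re z = (1 - Im z) * real m"
        using Up[of z n] Up[of z m] by blast+
      then have "(1 - Im z) * real n = (1 - Im z) * real m" by linarith
      \<comment> \<open>Distinct feet force \<open>1 - Im z\<close> to vanish, which leaves the apex
        only.\<close>
      then have "Im z = 1" using that by simp
      then have "z = book_point 18" using *(1) by (simp add: complex_eq_iff book_point_simps)
      then show "z \<in> book_point ` ({n, 18} \<inter> {m, 18})" by (rule apex)
    qed
    have LL: "Lo n \<inter> Lo m \<subseteq> book_point ` ({n, 19} \<inter> {m, 19})" if "n \<noteq> m" for n m
    proof
      fix z assume "z \<in> Lo n \<inter> Lo m"
      then have *: "Re z = (1 + Im z) * real n" "Re z = (1 + Im z) * real m"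
        using Lo[of z n] Lo[of z m] by blast+
      then have "(1 + Im z) * real n = (1 + Im z) * real m" by linarith
      then have "1 + Im z = 0" using that by simp
      then have "z = book_point 19" using *(1) by (simp add: complex_eq_iff book_point_simps)
      then show "z \<in> book_point ` ({n, 19} \<inter> {m, 19})" by (rule apex)
    qed
    have UL: "Up n \<inter> Lo m \<subseteq> book_point ` ({n, 18} \<inter> {m, 19})" if "n < 18" for n m
    proof
      fix z assume "z \<in> Up n \<inter> Lo m"
      then have "Im z = 0" "Re z = (1 - Im z) * real n" "Re z = (1 + Im z) * real m"
        using Up[of z n] Lo[of z m] by auto
      then have "z = of_nat n" "n = m" by (simp_all add: complex_eq_iff)
      then show "z \<in> book_point ` ({n, 18} \<inter> {m, 19})" using that by (intro foot) auto
    qed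
    have M: "z \<in> book_point ` ({n, v} \<inter> {2 * i, 2 * i + 1})"
      if "n < 18" "z \<in> Mi i" "Re z = real n" for z n v i
    proof -
      have "z = of_nat n" "2 * real i \<le> real n" "real n \<le> 2 * real i + 1"
        using that(2,3) by (auto simp: Mi complex_eq_iff)
      moreover from this have "n = 2 * i \<or> n = 2 * i + 1" by linarith
      ultimately show ?thesis using that(1) by (intro foot)
    qed
    have UM: "Up n \<inter> Mi i \<subseteq> book_point ` ({n, 18} \<inter> {2 * i, 2 * i + 1})" if "n < 18" for n i
    proof
      fix z assume z: "z \<in> Up n \<inter> Mi i"
      then have "Re z = real n" by (simp add: Up Mi)
      then show "z \<in> book_point ` ({n, 18} \<inter> {2 * i, 2 * i + 1})" using M that z by blast
    qed
    have LM: "Lo n \<inter> Mi i \<subseteq> book_point ` ({n, 19} \<inter> {2 * i, 2 * i + 1})" if "n < 18" for n i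
    proof
      fix z assume z: "z \<in> Lo n \<inter> Mi i"
      then have "Re z = real n" by (simp add: Lo Mi)
      then show "z \<in> book_point ` ({n, 19} \<inter> {2 * i, 2 * i + 1})" using M that z by blast
    qed
    have MM: "Mi i \<inter> Mi j = {}" if "i \<noteq> j" for i j
    proof -
      have False if "z \<in> Mi i" "z \<in> Mi j" for z
      proof -
        have "2 * real i \<le> 2 * real j + 1" "2 * real j \<le> 2 * real i + 1" using that by (auto simp: Mi)
        then show False using \<open>i \<noteq> j\<close> by linarith
      qed
      then show ?thesis by blast
    qed
    have sym: "?Q f e \<Longrightarrow> ?Q e f" by (simp only: Int_commute)
    from cases[OF e] show "?Q e f"
    proof (elim disjE exE conjE)
      fix n assume n: "n < 18" "e = {n, 18}" "path_image (?\<gamma> e) = Up n"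
      from cases[OF f] show "?Q e f"
      proof (elim disjE exE conjE)
        fix m assume m: "m < 18" "f = {m, 18}" "path_image (?\<gamma> f) = Up m"
        then have "n \<noteq> m" using ef n by auto
        then show "?Q e f" unfolding n(3) m(3) unfolding n(2) m(2) by (rule UU)
      next
        fix m assume m: "m < 18" "f = {m, 19}" "path_image (?\<gamma> f) = Lo m"
        show "?Q e f" unfolding n(3) m(3) unfolding n(2) m(2) by (rule UL[OF n(1)])
      next
        fix i assume m: "i < 9" "f = {2 * i, 2 * i + 1}" "path_image (?\<gamma> f) = Mi i"
        show "?Q e f" unfolding n(3) m(3) unfolding n(2) m(2) by (rule UM[OF n(1)])
      qed
    next
      fix n assume n: "n < 18" "e = {n, 19}" "path_image (?\<gamma> e) = Lo n"
      from cases[OF f] show "?Q e f"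
      proof (elim disjE exE conjE)
        fix m assume m: "m < 18" "f = {m, 18}" "path_image (?\<gamma> f) = Up m"
        have "?Q f e" unfolding n(3) m(3) unfolding n(2) m(2) by (rule UL[OF m(1)])
        then show "?Q e f" by (rule sym)
      next
        fix m assume m: "m < 18" "f = {m, 19}" "path_image (?\<gamma> f) = Lo m"
        then have "n \<noteq> m" using ef n by auto
        then show "?Q e f" unfolding n(3) m(3) unfolding n(2) m(2) by (rule LL)
      next
        fix i assume m: "i < 9" "f = {2 * i, 2 * i + 1}" "path_image (?\<gamma> f) = Mi i"
        show "?Q e f" unfolding n(3) m(3) unfolding n(2) m(2) by (rule LM[OF n(1)])
      qed
    next
      fix i assume n: "i < 9" "e = {2 * i, 2 * i + 1}" "path_image (?\<gamma> e) = Mi i"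
      from cases[OF f] show "?Q e f"
      proof (elim disjE exE conjE)
        fix m assume m: "m < 18" "f = {m, 18}" "path_image (?\<gamma> f) = Up m"
        have "?Q f e" unfolding n(3) m(3) unfolding n(2) m(2) by (rule UM[OF m(1)])
        then show "?Q e f" by (rule sym)
      next
        fix m assume m: "m < 18" "f = {m, 19}" "path_image (?\<gamma> f) = Lo m"
        have "?Q f e" unfolding n(3) m(3) unfolding n(2) m(2) by (rule LM[OF m(1)])
        then show "?Q e f" by (rule sym)
      next
        fix j assume m: "j < 9" "f = {2 * j, 2 * j + 1}" "path_image (?\<gamma> f) = Mi j"
        then have "i \<noteq> j" using ef n by auto
        then show "?Q e f" unfolding n(3) m(3) by (simp add: MM)
      qed
    qed
  qed
qed

text \<open>Vertices 18 and 19 get disjoint lists, and the edge \<open>{2i, 2i+1}\<close> is responsible for the \<open>i\<close>-th of the nine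
  pairs of colours \<open>(a, b)\<close> there: its ends lose \<open>-a\<close> and \<open>-b\<close>, and the colours \<open>7\<close> and \<open>-7\<close> left to
  them conflict.\<close>

lemma book_graph_not_choosable:
  shows "\<not> choosable {..<20} book_graph (\<lambda>_. -1) 3"
proof
  assume ch: "choosable {..<20} book_graph (\<lambda>_. -1) 3"
  \<comment> \<open>The two base-3 digits of the edge number \<open>n div 2\<close> encode the pair
    of colours. Values from 1 to 6 in disjoint ranges keep \<open>- a n\<close>,
    \<open>- b n\<close> and \<open>\<plusminus>7\<close> distinct, so that every list has three
    elements.\<close>
  define a b where "a n = (1 + int (n div 2 div 3))" and "b n = (4 + int (n div 2 mod 3))" for n :: nat
  define L :: "nat \<Rightarrow> int set" where
    "L n = (if n = 18 then {1, 2, 3} else if n = 19 then {4, 5, 6}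
            else {- a n, - b n, if even n then 7 else -7})" for n
  have ab: "a n \<in> {1, 2, 3}" "b n \<in> {4, 5, 6}" if "n < 18" for n
  proof -
    have "n div 2 div 3 \<in> {0, 1, 2}" "n div 2 mod 3 \<in> {0, 1, 2}" using that by auto
    then show "a n \<in> {1, 2, 3}" "b n \<in> {4, 5, 6}" by (auto simp: a_def b_def)
  qed
  have "card (L n) = 3" if "n < 20" for n
  proof (cases "n < 18")
    case True
    then show ?thesis using ab[OF True] by (auto simp: L_def)
  next
    case False
    then have "n = 18 \<or> n = 19" using that by auto
    then show ?thesis by (auto simp: L_def)
  qed
  then have "list_assignment {..<20} 3 L" by (auto simp: list_assignment_def L_def)
  then obtain \<phi> where \<phi>: "list_coloring {..<20} book_graph (\<lambda>_. -1) L \<phi>"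
    using ch unfolding choosable_def by blast
  have \<phi>L: "\<phi> v \<in> L v" if "v < 20" for v using \<phi> that by (simp add: list_coloring_def)
  have adj: "\<phi> u \<noteq> - \<phi> v" if "{u, v} \<in> book_graph" "u < 20" "v < 20" for u v
    using \<phi> that by (simp add: list_coloring_def proper_coloring_def)
  \<comment> \<open>The inverse encoding: the edge responsible for the pair of colours that
    \<open>\<phi>\<close> uses at 18 and 19.\<close>
  define i where "i = nat (3 * (\<phi> 18 - 1) + (\<phi> 19 - 4))"
  have x: "\<phi> 18 \<in> {1, 2, 3}" and y: "\<phi> 19 \<in> {4, 5, 6}" using \<phi>L[of 18] \<phi>L[of 19] by (simp_all add: L_def)
  have i: "i < 9" "1 + int (i div 3) = \<phi> 18" "4 + int (i mod 3) = \<phi> 19"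
    using x y by (auto simp: i_def)
  have abi: "a (2 * i) = \<phi> 18" "b (2 * i) = \<phi> 19" "a (2 * i + 1) = \<phi> 18" "b (2 * i + 1) = \<phi> 19"
    using i by (simp_all add: a_def b_def)
  have E: "{2 * i, 18} \<in> book_graph" "{2 * i, 19} \<in> book_graph" "{2 * i + 1, 18} \<in> book_graph"
      "{2 * i + 1, 19} \<in> book_graph" "{2 * i, 2 * i + 1} \<in> book_graph"
    using i(1) unfolding book_graph_def by auto
  have "\<phi> (2 * i) = 7"
    using \<phi>L[of "2 * i"] adj[OF E(1)] adj[OF E(2)] i(1) abi by (auto simp: L_def)
  moreover have "\<phi> (2 * i + 1) = - 7"
    using \<phi>L[of "2 * i + 1"] adj[OF E(3)] adj[OF E(4)] i(1) abi by (auto simp: L_def)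
  ultimately show False using adj[OF E(5)] i(1) by auto
qed

theorem theorem1p5:
  shows "(\<forall>(V :: 'a::linorder set) E \<sigma>.
            signed_graph V E \<sigma> \<and> planar V E \<and> colorable V E \<sigma> 2 \<longrightarrow> AT_number V E \<sigma> \<le> 4) \<and>
         (\<exists>(V :: nat set) E \<sigma>.
            signed_graph V E \<sigma> \<and> planar V E \<and> colorable V E \<sigma> 2 \<and> \<not> choosable V E \<sigma> 3)"
proof (intro conjI allI impI)
  fix V :: "'a set" and E \<sigma>
  assume "signed_graph V E \<sigma> \<and> planar V E \<and> colorable V E \<sigma> 2"
  then show "AT_number V E \<sigma> \<le> 4" using planar_AT_number_le_4 by blast
next
  have "signed_graph {..<20} book_graph (\<lambda>_. -1)"
    by (auto simp: signed_graph_def book_graph_def)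
  moreover have "colorable {..<20} book_graph (\<lambda>_. -1) 2"
    unfolding colorable_def
    by (rule exI[of _ "\<lambda>_. 1"]) (simp add: proper_coloring_def sym_colors_def)
  ultimately show "\<exists>(V :: nat set) E \<sigma>.
      signed_graph V E \<sigma> \<and> planar V E \<and> colorable V E \<sigma> 2 \<and> \<not> choosable V E \<sigma> 3"
    using planar_book_graph book_graph_not_choosable by blast
qed

end
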